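(* Let $d\ge 2$, let $(a_n^{(1)})_{n\ge1},\ldots,(a_n^{(d)})_{n\ge1}$ be strictly increasing sequences of natural numbers, and $\boldsymbol{a}_n=(a_n^{(1)},\ldots,a_n^{(d)})$. Let $\delta_{\min}(\boldsymbol{\alpha},N)$ denote the minimal gap of the one-dimensional sequence $(\{\boldsymbol{a}_n\cdot\boldsymbol{\alpha}\})_n$. If $\min_{i\leq d}E(A_N^{\{i\}})\ll N^{2+o(1)}$ for $N\gg1$, then for all $\delta>0$, for almost all $\boldsymbol{\alpha}\in[0,1]^d$, $$\delta_{\min}(\boldsymbol{\alpha},N)\leq\frac{N^{\delta}}{N^2}\quad\text{for all sufficiently large }N.$$
   Context: Notation. $\{\cdot\}$ is the fractional part and "almost all" refers to Lebesgue measure on $[0,1]^d$; "sufficiently large" may depend on $\boldsymbol{\alpha}$. The condition $\min_{i\le d} E(A_N^{\{i\}})\ll N^{2+o(1)}$ means that for every $\eta>0$ the left-hand side is $\ll_\eta N^{2+\eta}$ for all large $N$ (the minimizing index $i$ may depend on $N$). For $\boldsymbol{\alpha}=(\alpha_1,\dots,\alpha_d)$, $\{\boldsymbol{a}_n\cdot\boldsymbol{\alpha}\}=\{a_n^{(1)}\alpha_1+\cdots+a_n^{(d)}\alpha_d\}\in[0,1)$. Minimal gap: for $x\in\mathbb{R}$ let $\|x\|=\min_{k\in\mathbb{Z}}|x+k|$. The minimal gap of a sequence $(x_n)$ in $[0,1)$ is $\min\{\|x_n-x_m\|:1\le n\ne m\le N\}$. Additive energy: $A_N^{\{i\}}=\{a_n^{(i)}:n\le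 N\}$ and $$E(A_N^{\{i\}})=\#\{(n_1,n_2,n_3,n_4)\in[1,N]^4\cap\mathbb{N}^4:a^{(i)}_{n_1}+a^{(i)}_{n_2}=a^{(i)}_{n_3}+a^{(i)}_{n_4}\}.$$ *)

theory Defs
  imports "HOL-Analysis.Analysis" "HOL-Library.Landau_Symbols"
begin

(* The infimum is a minimum, see dist_int_attained. *)
definition dist_int :: "real \<Rightarrow> real" where
  "dist_int x = (INF k::int. \<bar>x + of_int k\<bar>)"

(* Only meaningful for N >= 2; for N < 2 there are no pairs and Min is applied to the empty set. *)
definition min_gap :: "(nat \<Rightarrow> real) \<Rightarrow> nat \<Rightarrow> real" where
  "min_gap x N = Min {dist_int (x n - x m) | n m. n \<in> {1..N} \<and> m \<in> {1..N} \<and> n \<noteq> m}"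

definition additive_energy :: "(nat \<Rightarrow> nat) \<Rightarrow> nat \<Rightarrow> nat" where
  "additive_energy b N =
     card {(n1, n2, n3, n4). n1 \<in> {1..N} \<and> n2 \<in> {1..N} \<and> n3 \<in> {1..N} \<and> n4 \<in> {1..N} \<and>
             b n1 + b n2 = b n3 + b n4}"

definition frac_dot :: "('d::finite \<Rightarrow> nat \<Rightarrow> nat) \<Rightarrow> real ^ 'd \<Rightarrow> nat \<Rightarrow> real" where
  "frac_dot a \<alpha> n = frac ((\<chi> i. real (a i n)) \<bullet> \<alpha>)"

lemma dist_int_attained: "\<exists>k::int. dist_int x = \<bar>x + of_int k\<bar>"
proof -
  let ?k = "- round x"
  have "\<bar>x + of_int ?k\<bar> \<le> \<bar>x + of_int j\<bar>" for j :: int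
    using round_diff_minimal[of x "- j"] by simp
  then have "dist_int x = \<bar>x + of_int ?k\<bar>"
    unfolding dist_int_def by (intro cInf_eq_minimum[OF rangeI]) auto
  then show ?thesis ..
qed

end

theory Submission
  imports Defs
begin

text \<open>The additive energy bound and the Cauchy-Schwarz inequality give, for each \<open>N\<close> and a suitable
  coordinate \<open>i\<close>, a set \<open>V\<close> of at least \<open>N powr (2 - \<eta>)\<close> distinct positive differences of the
  sequence \<open>a i\<close>. Take \<open>H\<close> about \<open>N powr (2 - \<delta> / 2)\<close>. If no difference vector comes
  within \<open>1 / H\<close> of an integer, then a cosine polynomial of degree \<open>< 2 * H\<close> that is nonpositive
  away from the integers, summed over the difference vectors, stays far below its mean. By
  Chebyshev, the measure of this event is at most a constant times
  \<open>#{(p, q, m, n). m * p = n * q} / (card V)\<^sup>2\<close> with \<open>p, q \<in> V\<close> and \<open>m, n \<le> 2 * H\<close>. This count is a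
  substitute for GCD sums; it is \<open>O((card V * H) powr (1 + \<epsilon>))\<close> by repeated
  Cauchy-Schwarz and the divisor bound. So the measure decays like a power of \<open>N\<close>, and the
  Borel-Cantelli lemma along \<open>N = 2 ^ k\<close> suffices because the minimal gap decreases in \<open>N\<close>.\<close>

section \<open>Multiplicative quadruples\<close>


text \<open>Cauchy-Schwarz over the fibres of \<open>f\<close>: their sizes add up to
  \<open>card S\<close>, and the squares of their sizes count the colliding pairs. It serves three
  times: for multiplicative quadruples, for the constant term of the cosine polynomial and for
  additive energy.\<close>

lemma card_square_le_card_image_mult_card_collisions:
  assumes "finite S"
  shows "(card S)\<^sup>2 \<le> card (f ` S) * card {(x, y). x \<in> S \<and> y \<in> S \<and> f x = f y}"
proof -
  define F where "F z = {x \<in> S. f x = z}" for z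
  have fin: "finite (F z)" for z using assms by (simp add: F_def)
  have S: "card S = (\<Sum>z\<in>f ` S. card (F z))"
    using sum.group[of S "f ` S" f "\<lambda>_. 1::nat"] assms by (simp add: F_def)
  have "{(x, y). x \<in> S \<and> y \<in> S \<and> f x = f y} = (\<Union>z\<in>f ` S. F z \<times> F z)"
    by (auto simp: F_def)
  also have "card \<dots> = (\<Sum>z\<in>f ` S. card (F z \<times> F z))"
    by (rule card_UN_disjoint) (use assms fin in \<open>auto simp: F_def\<close>)
  finally have E: "card {(x, y). x \<in> S \<and> y \<in> S \<and> f x = f y} = (\<Sum>z\<in>f ` S. (card (F z))\<^sup>2)"
    by (simp add: card_cartesian_product power2_eq_square)
  have "(\<Sum>z\<in>f ` S. real (card (F z)))\<^sup>2 \<le> (\<Sum>z\<in>f ` S. (real (card (F z)))\<^sup>2) * card (f ` S)"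
    by (rule sum_squared_le_sum_of_squares)
  then have "real ((card S)\<^sup>2) \<le> real (card (f ` S) * card {(x, y). x \<in> S \<and> y \<in> S \<and> f x = f y})"
    unfolding S E by (simp add: mult.commute)
  then show ?thesis by (simp only: of_nat_le_iff)
qed

section \<open>The divisor bound by moments\<close>

definition divisor_count :: "nat \<Rightarrow> nat" where
  "divisor_count n = card {d. d dvd n}"

lemma divisor_count_mult_le:
  assumes "m > 0" "n > 0"
  shows "divisor_count (m * n) \<le> divisor_count m * divisor_count n"
proof -
  have fin: "finite ({d. d dvd m} \<times> {d. d dvd n})"
    using assms by simp
  have "{d. d dvd m * n} \<subseteq> (\<lambda>(a, b). a * b) ` ({d. d dvd m} \<times> {d. d dvd n})"
    using division_decomp by (auto simp: image_iff) blast
  from surj_card_le[OF fin this] show ?thesis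
    by (simp add: divisor_count_def card_cartesian_product)
qed

text \<open>Writing \<open>n = d * f\<close> for each divisor \<open>d\<close> turns one factor \<open>divisor_count n\<close> into a double sum, so
  by submultiplicativity the bound for the exponent \<open>Suc s\<close> is the square of the one for \<open>s\<close>.\<close>

lemma divisor_count_moment_bounded:
  "\<exists>C::real. \<forall>X. (\<Sum>n=1..X. real (divisor_count n) ^ s / (real n)\<^sup>2) \<le> C"
proof (induction s)
  case 0
  have "summable (\<lambda>n. inverse (real n ^ 2))"
    by (rule inverse_power_summable) simp
  then have "(\<Sum>n=1..X. inverse (real n ^ 2)) \<le> (\<Sum>n. inverse (real n ^ 2))" for X
    by (rule sum_le_suminf) auto
  then show ?case by (auto simp: divide_inverse)
next
  case (Suc s)
  then obtain C where C: "\<And>X. (\<Sum>n=1..X. real (divisor_count n) ^ s / (real n)\<^sup>2) \<le> C" by blast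
  have "(\<Sum>n=1..X. real (divisor_count n) ^ Suc s / (real n)\<^sup>2) \<le> C\<^sup>2" for X
  proof -
    define h where "h n = real (divisor_count n) ^ s / (real n)\<^sup>2" for n
    have h0: "h n \<ge> 0" for n by (simp add: h_def)
    have hmult: "h (a * b) \<le> h a * h b" if "a > 0" "b > 0" for a b
    proof -
      have "real (divisor_count (a * b)) ^ s \<le> (real (divisor_count a) * real (divisor_count b)) ^ s"
        using divisor_count_mult_le[OF that] by (intro power_mono) (simp_all flip: of_nat_mult)
      then show ?thesis
        by (simp add: h_def power_mult_distrib divide_right_mono)
    qed
    have "(\<Sum>n=1..X. real (divisor_count n) ^ Suc s / (real n)\<^sup>2) = (\<Sum>n=1..X. \<Sum>d | d dvd n. h n)"
      by (simp add: h_def divisor_count_def)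
    also have "\<dots> = (\<Sum>(n, d)\<in>(SIGMA n:{1..X}. {d. d dvd n}). h n)"
      by (rule sum.Sigma) auto
    also have "\<dots> = (\<Sum>(e, f)\<in>(\<lambda>(n, d). (d, n div d)) ` (SIGMA n:{1..X}. {d. d dvd n}). h (e * f))"
      by (subst sum.reindex) (auto simp: inj_on_def intro!: sum.cong)
    \<comment> \<open>Pairs with \<open>e * f > X\<close> are added to complete the square; this is
      harmless since \<open>h\<close> is nonnegative.\<close>
    also have "\<dots> \<le> (\<Sum>(e, f)\<in>{1..X} \<times> {1..X}. h (e * f))"
    proof (rule sum_mono2)
      show "(\<lambda>(n, d). (d, n div d)) ` (SIGMA n:{1..X}. {d. d dvd n}) \<subseteq> {1..X} \<times> {1..X}"
        by (auto simp: Suc_le_eq dvd_pos_nat div_greater_zero_iff dest: dvd_imp_le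
              intro: order_trans[OF div_le_dividend] order_trans[OF dvd_imp_le])
    qed (auto simp: h0)
    also have "\<dots> \<le> (\<Sum>(e, f)\<in>{1..X} \<times> {1..X}. h e * h f)"
      by (intro sum_mono) (auto intro!: hmult)
    also have "\<dots> = (\<Sum>n=1..X. h n)\<^sup>2"
      by (simp add: power2_eq_square sum_product sum.cartesian_product)
    also have "\<dots> \<le> C\<^sup>2"
      using C[of X] by (intro power_mono) (auto simp: h_def[symmetric] intro!: sum_nonneg h0)
    finally show ?thesis .
  qed
  then show ?case by blast
qed

text \<open>A single term of the bounded moment sum is bounded, so
  \<open>divisor_count n ^ s\<close> is at most a constant times \<open>n\<^sup>2\<close>. The
  \<open>s\<close>-th root leaves the exponent \<open>2 / s\<close>, which is below
  \<open>\<epsilon>\<close> for large \<open>s\<close>.\<close>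

lemma divisor_count_le_powr:
  assumes "\<epsilon> > 0"
  obtains C where "C > 0" "\<And>n. n > 0 \<Longrightarrow> real (divisor_count n) \<le> C * real n powr \<epsilon>"
proof -
  obtain s :: nat where s: "2 / \<epsilon> < s" using reals_Archimedean2 by blast
  moreover have "2 / \<epsilon> > 0" using assms by simp
  ultimately have "real s > 0" by linarith
  then have s0: "s > 0" by simp
  then have s1: "2 / real s < \<epsilon>" using s assms by (simp add: field_simps)
  obtain B where B: "\<And>X. (\<Sum>n=1..X. real (divisor_count n) ^ s / (real n)\<^sup>2) \<le> B"
    using divisor_count_moment_bounded by blast
  define C where "C = (max B 1) powr (1 / s)"
  have "real (divisor_count n) \<le> C * real n powr \<epsilon>" if "n > 0" for n
  proof -
    have "real (divisor_count n) ^ s / (real n)\<^sup>2 \<le> (\<Sum>n=1..n. real (divisor_count n) ^ s / (real n)\<^sup>2)"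
      using that by (intro member_le_sum) auto
    also have "\<dots> \<le> max B 1" using B[of n] by simp
    finally have *: "real (divisor_count n) ^ s \<le> max B 1 * real n powr 2"
      using that by (simp add: field_simps powr_numeral)
    have "real (divisor_count n) = (real (divisor_count n) ^ s) powr (1 / s)"
      using s0 by (simp add: powr_powr flip: powr_realpow')
    also have "\<dots> \<le> (max B 1 * real n powr 2) powr (1 / s)"
      using * by (intro powr_mono2) auto
    also have "\<dots> = C * real n powr (2 / s)"
      by (simp add: C_def powr_mult powr_powr flip: powr_numeral)
    also have "\<dots> \<le> C * real n powr \<epsilon>"
      using s1 that by (intro mult_left_mono powr_mono) (auto simp: C_def)
    finally show ?thesis .
  qed
  moreover have "C > 0" by (simp add: C_def)
  ultimately show ?thesis using that by blast
qed

text \<open>For positive \<open>p\<close> and \<open>q\<close> the pairs \<open>(m, n)\<close> are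
  the multiples of \<open>(q div gcd p q, p div gcd p q)\<close> inside the box,
  \<open>L * gcd p q div max p q\<close> in number, so the cardinality is a kind of GCD sum over
  \<open>V\<close>.\<close>

definition mult_quads :: "nat set \<Rightarrow> nat \<Rightarrow> (nat \<times> nat \<times> nat \<times> nat) set" where
  "mult_quads V L = {(p, q, m, n). p \<in> V \<and> q \<in> V \<and> m \<in> {1..L} \<and> n \<in> {1..L} \<and> m * p = n * q}"

lemma finite_mult_quads: "finite V \<Longrightarrow> finite (mult_quads V L)"
  by (rule finite_subset[of _ "V \<times> V \<times> {1..L} \<times> {1..L}"]) (auto simp: mult_quads_def)

text \<open>As \<open>q\<close> is positive, \<open>p\<close>, \<open>q\<close> and \<open>m\<close>
  determine \<open>n\<close>.\<close>

lemma card_mult_quads_trivial: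
  assumes "finite V" "0 \<notin> V"
  shows "card (mult_quads V L) \<le> (card V)\<^sup>2 * L"
proof -
  have "card (mult_quads V L) \<le> card (V \<times> V \<times> {1..L})"
    using assms by (intro card_inj_on_le[where f = "\<lambda>(p, q, m, n). (p, q, m)"])
      (auto simp: inj_on_def mult_quads_def)
  then show ?thesis by (simp add: card_cartesian_product power2_eq_square)
qed

text \<open>Cauchy-Schwarz over \<open>q\<close>: two solutions \<open>m * p = n * q\<close>, \<open>m' * p' = n' * q\<close> sharing \<open>q\<close> combine to
  \<open>(m * n') * p = (n * m') * p'\<close>, and the divisor bound controls how often this happens.\<close>

lemma card_mult_quads_square_le:
  assumes "finite V" "0 \<notin> V" and D: "\<And>k. k \<in> {1..L\<^sup>2} \<Longrightarrow> divisor_count k \<le> D"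
  shows "(card (mult_quads V L))\<^sup>2 \<le> card V * (D\<^sup>2 * card (mult_quads V (L\<^sup>2)))"
proof -
  let ?S = "mult_quads V L" and ?f = "\<lambda>(p, q, m, n). q :: nat"
  let ?E = "{(x, y). x \<in> ?S \<and> y \<in> ?S \<and> ?f x = ?f y}"
  \<comment> \<open>A pair of solutions with common \<open>q\<close> is encoded by the combined
    quadruple with \<open>k = m * n'\<close> and \<open>l = n * m'\<close>, together with
    \<open>m\<close> as a divisor of \<open>k\<close> and \<open>n\<close> as a divisor of
    \<open>l\<close>.\<close>
  let ?T = "SIGMA (p, p', k, l):mult_quads V (L\<^sup>2). {d. d dvd k} \<times> {d. d dvd l}"
  let ?\<phi> = "\<lambda>((p, q, m, n), (p', q', m', n')). ((p, p', m * n', n * m'), (m, n :: nat)) ::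
              (nat \<times> nat \<times> nat \<times> nat) \<times> nat \<times> nat"
  have finT: "finite ?T"
    using assms by (intro finite_SigmaI finite_mult_quads) (auto simp: mult_quads_def)
  have "?\<phi> ` ?E \<subseteq> ?T"
  proof -
    have 1: "m * n' * p = n * m' * p'" if "m * p = n * q" "m' * p' = n' * q" for m n p q m' n' p' :: nat
      using that by (metis mult.assoc mult.commute)
    have 2: "m * n \<le> L\<^sup>2" if "m \<le> L" "n \<le> L" for m n
      using mult_le_mono[OF that] by (simp add: power2_eq_square)
    show ?thesis
    proof (rule image_subsetI)
      fix z assume "z \<in> ?E"
      then obtain p q m n p' m' n' where z: "z = ((p, q, m, n), (p', q, m', n'))"
        and "(p, q, m, n) \<in> ?S" "(p', q, m', n') \<in> ?S"
        by auto
      then have *: "p \<in> V" "p' \<in> V" "m * p = n * q" "m' * p' = n' * q"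
        "1 \<le> m" "m \<le> L" "1 \<le> n" "n \<le> L" "1 \<le> m'" "m' \<le> L" "1 \<le> n'" "n' \<le> L"
        by (auto simp: mult_quads_def)
      then show "?\<phi> z \<in> ?T"
        using 1[OF *(3,4)] by (simp add: mult_quads_def 2 z)
    qed
  qed
  \<comment> \<open>\<open>n'\<close> and \<open>m'\<close> are recovered as the cofactors of
    \<open>m\<close> and \<open>n\<close>, and \<open>q\<close> from
    \<open>m * p = n * q\<close>.\<close>
  moreover have "inj_on ?\<phi> ?E"
    using assms(2) by (auto simp: inj_on_def mult_quads_def)
  ultimately have "card ?E \<le> card ?T"
    using finT by (intro card_inj_on_le)
  also have "\<dots> = (\<Sum>(p, p', k, l)\<in>mult_quads V (L\<^sup>2). divisor_count k * divisor_count l)"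
    using assms finite_mult_quads[OF assms(1)]
    by (subst card_SigmaI) (auto simp: mult_quads_def divisor_count_def card_cartesian_product intro!: sum.cong)
  also have "\<dots> \<le> (\<Sum>x\<in>mult_quads V (L\<^sup>2). D\<^sup>2)"
    by (intro sum_mono) (auto simp: mult_quads_def power2_eq_square intro!: mult_le_mono D)
  finally have E: "card ?E \<le> D\<^sup>2 * card (mult_quads V (L\<^sup>2))" by (simp add: mult.commute)
  have "card (?f ` ?S) \<le> card V"
    using assms by (intro card_mono) (auto simp: mult_quads_def)
  then show ?thesis
    using card_square_le_card_image_mult_card_collisions[OF finite_mult_quads[OF assms(1)], of L ?f] E
    by (meson mult_le_mono order_trans)
qed

text \<open>Induction from the trivial bound, where \<open>card V\<close> has exponent
  \<open>2\<close>. One Cauchy-Schwarz step turns an exponent \<open>1 + t\<close> of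
  \<open>card V\<close> into \<open>1 + t / 2\<close>. It also squares \<open>L\<close>, which the
  square root undoes up to small powers coming from the divisor bound; hence
  \<open>\<epsilon>\<close> varies in the induction.\<close>

lemma card_mult_quads_le_dyadic:
  assumes "\<epsilon> > 0"
  shows "\<exists>C>0. \<forall>V L. finite V \<longrightarrow> 0 \<notin> V \<longrightarrow> L > 0 \<longrightarrow>
           real (card (mult_quads V L)) \<le> C * real (card V) powr (1 + 1 / 2 ^ j) * real L powr (1 + \<epsilon>)"
  using assms
proof (induction j arbitrary: \<epsilon>)
  case 0
  have "real (card (mult_quads V L)) \<le> 1 * real (card V) powr (1 + 1 / 2 ^ 0) * real L powr (1 + \<epsilon>)"
    if "finite V" "0 \<notin> V" "L > 0" for V L
  proof -
    have "real (card (mult_quads V L)) \<le> real ((card V)\<^sup>2 * L)"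
      using card_mult_quads_trivial[OF that(1,2), of L] by (simp only: of_nat_le_iff)
    also have "\<dots> = real (card V) powr 2 * real L powr 1"
      using that by (simp add: powr_numeral)
    also have "\<dots> \<le> real (card V) powr 2 * real L powr (1 + \<epsilon>)"
      using 0 that by (intro mult_left_mono powr_mono) auto
    finally show ?thesis by simp
  qed
  then show ?case by (intro exI[of _ 1]) auto
next
  case (Suc j)
  \<comment> \<open>In the squared estimate the divisor factors contribute
    \<open>L powr (4 * \<epsilon>')\<close> and the induction hypothesis at \<open>L\<^sup>2\<close>
    contributes \<open>L powr (2 + 2 * \<epsilon>')\<close>; the total exponent has to be
    \<open>2 + 2 * \<epsilon>\<close>.\<close>
  define \<epsilon>' where "\<epsilon>' = \<epsilon> / 3"
  have e': "\<epsilon>' > 0" using Suc.prems by (simp add: \<epsilon>'_def)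
  from Suc.IH[OF e'] obtain C where C: "C > 0" "\<And>V L. finite V \<Longrightarrow> 0 \<notin> V \<Longrightarrow> L > 0 \<Longrightarrow>
           real (card (mult_quads V L)) \<le> C * real (card V) powr (1 + 1 / 2 ^ j) * real L powr (1 + \<epsilon>')"
    by blast
  obtain B where B: "B > 0" "\<And>n. n > 0 \<Longrightarrow> real (divisor_count n) \<le> B * real n powr \<epsilon>'"
    using divisor_count_le_powr[OF e'] by blast
  have "real (card (mult_quads V L)) \<le> (sqrt C * B) * real (card V) powr (1 + 1 / 2 ^ Suc j) * real L powr (1 + \<epsilon>)"
    if V: "finite V" "0 \<notin> V" "L > 0" for V L
  proof (rule power2_le_imp_le)
    define D where "D = nat \<lfloor>B * real (L\<^sup>2) powr \<epsilon>'\<rfloor>"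
    have D: "divisor_count k \<le> D" if "k \<in> {1..L\<^sup>2}" for k
    proof -
      have "real (divisor_count k) \<le> B * real k powr \<epsilon>'" using B(2) that by simp
      also have "\<dots> \<le> B * real (L\<^sup>2) powr \<epsilon>'"
        using that B(1) e' by (intro mult_left_mono powr_mono2) (auto simp del: of_nat_power)
      finally show ?thesis unfolding D_def by (simp add: le_nat_floor)
    qed
    have Dle: "real D \<le> B * real L powr (2 * \<epsilon>')"
      using B(1) V(3) by (simp add: D_def powr_powr flip: powr_numeral)
    have "(real (card (mult_quads V L)))\<^sup>2 \<le> real (card V) * ((real D)\<^sup>2 * real (card (mult_quads V (L\<^sup>2))))"
      using card_mult_quads_square_le[OF V(1,2) D] by (simp flip: of_nat_power of_nat_mult)
    also have "\<dots> \<le> real (card V) * ((B * real L powr (2 * \<epsilon>'))\<^sup>2 *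
         (C * real (card V) powr (1 + 1 / 2 ^ j) * real (L\<^sup>2) powr (1 + \<epsilon>')))"
      using Dle C(2)[OF V(1,2), of "L\<^sup>2"] V(3)
      by (intro mult_left_mono mult_mono power_mono) auto
    also have "\<dots> = (sqrt C * B * real (card V) powr (1 + 1 / 2 ^ Suc j) * real L powr (1 + \<epsilon>))\<^sup>2"
    proof -
      have "real (card V) * real (card V) powr (1 + 1 / 2 ^ j) = (real (card V) powr (1 + 1 / 2 ^ Suc j))\<^sup>2"
      proof (cases "card V = 0")
        case False
        then show ?thesis
          by (simp add: power2_eq_square flip: powr_add powr_mult_base)
      qed simp
      moreover have "(real L powr (2 * \<epsilon>'))\<^sup>2 * real (L\<^sup>2) powr (1 + \<epsilon>') = (real L powr (1 + \<epsilon>))\<^sup>2"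
        using V(3) by (simp add: power2_eq_square powr_mult \<epsilon>'_def add_ac flip: powr_add)
      moreover have "X * ((B * P)\<^sup>2 * (C * Y * R)) = (sqrt C * B * Z * S)\<^sup>2"
        if "X * Y = Z\<^sup>2" "P\<^sup>2 * R = S\<^sup>2" for X Y Z P R S :: real
      proof -
        have "X * ((B * P)\<^sup>2 * (C * Y * R)) = C * B\<^sup>2 * (X * Y) * (P\<^sup>2 * R)"
          by (simp add: power_mult_distrib mult_ac)
        then show ?thesis using C(1) by (simp add: that power_mult_distrib)
      qed
      ultimately show ?thesis by blast
    qed
    finally show "(real (card (mult_quads V L)))\<^sup>2 \<le> (sqrt C * B * real (card V) powr (1 + 1 / 2 ^ Suc j) * real L powr (1 + \<epsilon>))\<^sup>2" .
  qed (use C(1) B(1) in auto)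
  then show ?case using C(1) B(1) by (intro exI[of _ "sqrt C * B"]) auto
qed

lemma card_mult_quads_le:
  assumes "\<epsilon> > 0"
  obtains C where "C > 0" "\<And>V L. finite V \<Longrightarrow> 0 \<notin> V \<Longrightarrow> L > 0 \<Longrightarrow>
    real (card (mult_quads V L)) \<le> C * real (card V) powr (1 + \<epsilon>) * real L powr (1 + \<epsilon>)"
proof -
  obtain j where "(1 / 2) ^ j < \<epsilon>" using real_arch_pow_inv[OF assms, of "1 / 2"] by auto
  then have j: "1 / 2 ^ j \<le> \<epsilon>" by (simp add: power_divide)
  obtain C where C: "C > 0" "\<And>V L. finite V \<Longrightarrow> 0 \<notin> V \<Longrightarrow> L > 0 \<Longrightarrow>
           real (card (mult_quads V L)) \<le> C * real (card V) powr (1 + 1 / 2 ^ j) * real L powr (1 + \<epsilon>)"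
    using card_mult_quads_le_dyadic[OF assms, of j] by blast
  have "real (card V) powr (1 + 1 / 2 ^ j) \<le> real (card V) powr (1 + \<epsilon>)" if "finite V" for V :: "nat set"
    by (cases "card V = 0") (auto intro!: powr_mono j)
  then show ?thesis
    using C by (intro that[of C]) (auto intro!: order_trans[OF C(2)] mult_right_mono mult_left_mono)
qed

section \<open>A cosine minorant\<close>


text \<open>For given \<open>x\<close> only \<open>k = f x + n\<close> and
  \<open>k = f x - n\<close> are possible, and a boolean tells them apart. This will bound the
  coefficients of the cosine polynomial.\<close>

lemma card_abs_diff_eq_le:
  fixes f :: "'a \<Rightarrow> int"
  assumes "finite X"
  shows "card {(x, k). x \<in> X \<and> k < H \<and> nat \<bar>f x - int k\<bar> = n} \<le> 2 * card X"
proof -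
  let ?S = "{(x, k). x \<in> X \<and> k < H \<and> nat \<bar>f x - int k\<bar> = n}"
  have "card ?S \<le> card (X \<times> (UNIV :: bool set))"
    by (rule card_inj_on_le[where f = "\<lambda>(x, k). (x, f x \<le> int k)"])
       (use assms in \<open>auto simp: inj_on_def\<close>)
  then show ?thesis by (simp add: card_cartesian_product mult.commute)
qed

text \<open>Cosine is even, so only the absolute value of \<open>f x\<close> matters: a sum over
  index tuples becomes a cosine polynomial whose coefficients are cardinalities.\<close>

lemma sum_cos_int_regroup:
  fixes f :: "'a \<Rightarrow> int"
  assumes "finite X" "\<And>x. x \<in> X \<Longrightarrow> nat \<bar>f x\<bar> < L"
  shows "(\<Sum>x\<in>X. cos (of_int (f x) * \<theta>)) = (\<Sum>n<L. real (card {x \<in> X. nat \<bar>f x\<bar> = n}) * cos (real n * \<theta>))"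
proof -
  have "(\<Sum>x\<in>X. cos (of_int (f x) * \<theta>)) = (\<Sum>n<L. \<Sum>x\<in>{x \<in> X. nat \<bar>f x\<bar> = n}. cos (of_int (f x) * \<theta>))"
    by (rule sum.group[symmetric]) (use assms in auto)
  also have "\<dots> = (\<Sum>n<L. \<Sum>x\<in>{x \<in> X. nat \<bar>f x\<bar> = n}. cos (real n * \<theta>))"
  proof (intro sum.cong refl)
    fix n x assume "x \<in> {x \<in> X. nat \<bar>f x\<bar> = n}"
    then have "real n = \<bar>of_int (f x)\<bar>" by auto
    then show "cos (of_int (f x) * \<theta>) = cos (real n * \<theta>)"
      by (cases "f x \<ge> 0") auto
  qed
  finally show ?thesis by simp
qed

text \<open>With \<open>W = \<bar>\<Sum>j<H. cis (j * \<theta>)\<bar>\<^sup>2\<close> one has \<open>(1 - cos \<theta>) * W = 1 - cos (H * \<theta>)\<close>, so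
  \<open>g = W * (\<kappa> * W - (1 - cos (H * \<theta>)))\<close> is nonpositive as soon as \<open>1 - cos \<theta> \<ge> \<kappa>\<close>. The choice
  \<open>\<kappa> = 4 / H\<^sup>2\<close> makes the constant term at least as large as a fixed proportion of every
  other coefficient.\<close>

lemma cosine_minorant:
  assumes "H > 0"
  obtains c :: "nat \<Rightarrow> real"
  where "c 0 \<ge> real H" "\<And>n. \<bar>c n\<bar> \<le> 12 * real H"
    "\<And>\<theta>. 1 - cos \<theta> \<ge> 4 / (real H)\<^sup>2 \<Longrightarrow> (\<Sum>n<2*H. c n * cos (real n * \<theta>)) \<le> 0"
proof -
  define X4 where "X4 = ({..<H} \<times> {..<H} \<times> {..<H}) \<times> {..<H}"
  define X2 where "X2 = {..<H} \<times> {..<H}"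
  \<comment> \<open>\<open>f4\<close>, \<open>f2\<close> and \<open>f3\<close> are the frequencies
    of \<open>W\<^sup>2\<close>, \<open>W\<close> and \<open>W * cos (H * \<theta>)\<close>, so that
    \<open>c\<close> lists the coefficients of
    \<open>\<kappa> * W\<^sup>2 - W + W * cos (H * \<theta>)\<close>.\<close>
  define f4 where "f4 = (\<lambda>((i, j, k), l). int i + int j - int k - int l)"
  define f2 where "f2 = (\<lambda>(i, j). int i - int j)"
  define f3 where "f3 = (\<lambda>(i, j). int i + int H - int j)"
  define r4 where "r4 n = real (card {x \<in> X4. nat \<bar>f4 x\<bar> = n})" for n
  define r2 where "r2 n = real (card {x \<in> X2. nat \<bar>f2 x\<bar> = n})" for n
  define r3 where "r3 n = real (card {x \<in> X2. nat \<bar>f3 x\<bar> = n})" for n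
  define \<kappa> where "\<kappa> = 4 / (real H)\<^sup>2"
  define c where "c n = \<kappa> * r4 n - r2 n + r3 n" for n
  have fin: "finite X4" "finite X2" by (auto simp: X4_def X2_def)
  have r2_le: "r2 n \<le> 2 * H" for n
  proof -
    have "{x \<in> X2. nat \<bar>f2 x\<bar> = n} = {(x, k). x \<in> {..<H} \<and> k < H \<and> nat \<bar>int x - int k\<bar> = n}"
      by (auto simp: X2_def f2_def)
    then show ?thesis unfolding r2_def
      using card_abs_diff_eq_le[of "{..<H}" H int n] by simp
  qed
  have r3_le: "r3 n \<le> 2 * H" for n
  proof -
    have "{x \<in> X2. nat \<bar>f3 x\<bar> = n} = {(x, k). x \<in> {..<H} \<and> k < H \<and> nat \<bar>(int x + int H) - int k\<bar> = n}"
      by (auto simp: X2_def f3_def)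
    then show ?thesis unfolding r3_def
      using card_abs_diff_eq_le[of "{..<H}" H "\<lambda>x. int x + int H" n] by simp
  qed
  have r4_le: "r4 n \<le> 2 * real H ^ 3" for n
  proof -
    let ?F = "\<lambda>(i, j, k). int i + int j - int k"
    have "{x \<in> X4. nat \<bar>f4 x\<bar> = n} = {(x, k). x \<in> {..<H} \<times> {..<H} \<times> {..<H} \<and> k < H \<and> nat \<bar>?F x - int k\<bar> = n}"
      by (auto simp: X4_def f4_def)
    then have "card {x \<in> X4. nat \<bar>f4 x\<bar> = n} \<le> 2 * H ^ 3"
      using card_abs_diff_eq_le[of "{..<H} \<times> {..<H} \<times> {..<H}" H ?F n]
      by (simp add: card_cartesian_product power3_eq_cube mult.assoc)
    then have "r4 n \<le> real (2 * H ^ 3)"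
      unfolding r4_def by (simp only: of_nat_le_iff)
    then show ?thesis by simp
  qed
  have k4: "\<kappa> * r4 n \<le> 8 * H" for n
  proof -
    have "\<kappa> * r4 n \<le> \<kappa> * (2 * real H ^ 3)"
      by (intro mult_left_mono r4_le) (simp add: \<kappa>_def)
    then show ?thesis using assms by (simp add: \<kappa>_def power2_eq_square power3_eq_cube)
  qed
  have nonneg: "r2 n \<ge> 0" "r3 n \<ge> 0" "\<kappa> * r4 n \<ge> 0" for n
    by (simp_all add: r2_def r3_def r4_def \<kappa>_def)
  \<comment> \<open>\<open>12 = 8 + 2 + 2\<close>, from \<open>k4\<close>, \<open>r2_le\<close> and
    \<open>r3_le\<close>.\<close>
  have "\<bar>c n\<bar> \<le> 12 * real H" for n
    using r2_le[of n] r3_le[of n] k4[of n] nonneg[of n] by (auto simp: c_def)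
  moreover have "c 0 \<ge> H"
  proof -
    have "{x \<in> X2. nat \<bar>f2 x\<bar> = 0} = (\<lambda>i. (i, i)) ` {..<H}"
      by (auto simp: X2_def f2_def)
    then have r2: "r2 0 = H"
      by (simp add: r2_def card_image inj_on_def)
    \<comment> \<open>\<open>r4 0\<close> counts the solutions of \<open>i + j = k + l\<close> below
      \<open>H\<close>. The sums take at most \<open>2 * H\<close> values, so Cauchy-Schwarz gives
      \<open>r4 0 \<ge> H ^ 3 / 2\<close>. Hence \<open>\<kappa> * r4 0 \<ge> 2 * H\<close>, twice
      the subtracted \<open>r2 0 = H\<close>.\<close>
    let ?s = "\<lambda>(i, j). i + j :: nat"
    have "card {(x, y). x \<in> X2 \<and> y \<in> X2 \<and> ?s x = ?s y} = card {x \<in> X4. nat \<bar>f4 x\<bar> = 0}"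
      by (rule bij_betw_same_card[of "\<lambda>((i, j), (k, l)). ((i, j, k), l)"])
         (auto simp: bij_betw_def inj_on_def X2_def X4_def f4_def image_iff; presburger)
    then have "(card X2)\<^sup>2 \<le> card (?s ` X2) * card {x \<in> X4. nat \<bar>f4 x\<bar> = 0}"
      using card_square_le_card_image_mult_card_collisions[OF fin(2), of ?s] by simp
    also have "card (?s ` X2) \<le> 2 * H"
    proof -
      have "?s ` X2 \<subseteq> {..<2 * H}" by (auto simp: X2_def)
      then show ?thesis using card_mono[of "{..<2 * H}" "?s ` X2"] by simp
    qed
    finally have "(card X2)\<^sup>2 \<le> 2 * H * card {x \<in> X4. nat \<bar>f4 x\<bar> = 0}" by simp
    then have "H * H ^ 3 \<le> H * (2 * card {x \<in> X4. nat \<bar>f4 x\<bar> = 0})"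
      by (simp add: X2_def card_cartesian_product power2_eq_square power3_eq_cube mult_ac)
    then have "H ^ 3 \<le> 2 * card {x \<in> X4. nat \<bar>f4 x\<bar> = 0}"
      using assms by simp
    then have "real (H ^ 3) \<le> real (2 * card {x \<in> X4. nat \<bar>f4 x\<bar> = 0})"
      by (simp only: of_nat_le_iff)
    then have "real H ^ 3 \<le> 2 * r4 0"
      by (simp add: r4_def)
    then have "\<kappa> * real H ^ 3 \<le> \<kappa> * (2 * r4 0)"
      by (intro mult_left_mono) (auto simp: \<kappa>_def)
    then have "2 * H \<le> \<kappa> * r4 0"
      using assms by (simp add: \<kappa>_def power2_eq_square power3_eq_cube)
    then show ?thesis using nonneg[of 0] by (simp add: c_def r2)
  qed
  moreover have "(\<Sum>n<2*H. c n * cos (real n * \<theta>)) \<le> 0" if \<theta>: "1 - cos \<theta> \<ge> 4 / (real H)\<^sup>2" for \<theta>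
  proof -
    define D where "D = (\<Sum>j<H. cis (real j * \<theta>))"
    define W where "W = (cmod D)\<^sup>2"
    have Wc: "complex_of_real W = D * cnj D"
      unfolding W_def by (rule complex_norm_square)
    have cnjD: "cnj D = (\<Sum>j<H. cis (- (real j * \<theta>)))"
      by (simp add: D_def cis_cnj)
    have W: "complex_of_real W = (\<Sum>i<H. \<Sum>j<H. cis (real i * \<theta> - real j * \<theta>))"
      unfolding Wc cnjD unfolding D_def by (simp add: sum_product cis_mult)
    have W2: "W = (\<Sum>x\<in>X2. cos (of_int (f2 x) * \<theta>))"
      using arg_cong[OF W, of Re]
      by (simp add: X2_def f2_def sum.cartesian_product algebra_simps case_prod_beta)
    have WH: "W * cos (H * \<theta>) = (\<Sum>x\<in>X2. cos (of_int (f3 x) * \<theta>))"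
    proof -
      have "W * cos (H * \<theta>) = (\<Sum>i<H. \<Sum>j<H. cos (real i * \<theta> - real j * \<theta>) * cos (H * \<theta>))"
        using arg_cong[OF W, of Re] by (simp add: sum_distrib_right)
      also have "\<dots> = (\<Sum>i<H. \<Sum>j<H. cos (real i * \<theta> - real j * \<theta> + H * \<theta>))
            + (\<Sum>i<H. \<Sum>j<H. sin (real i * \<theta> - real j * \<theta>) * sin (H * \<theta>))"
        by (simp add: cos_add flip: sum.distrib)
      \<comment> \<open>\<open>W\<close> is real, so the imaginary part of its double sum, a sum of
        sines, vanishes.\<close>
      also have "(\<Sum>i<H. \<Sum>j<H. sin (real i * \<theta> - real j * \<theta>) * sin (H * \<theta>)) = 0"
        using arg_cong[OF W, of Im] by (simp flip: sum_distrib_right)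
      finally show ?thesis
        by (simp add: X2_def f3_def sum.cartesian_product algebra_simps case_prod_beta)
    qed
    have WW: "W\<^sup>2 = (\<Sum>x\<in>X4. cos (of_int (f4 x) * \<theta>))"
    proof -
      have "complex_of_real (W\<^sup>2) = D * (D * (cnj D * cnj D))"
        by (simp add: power2_eq_square Wc mult_ac)
      also have "\<dots> = (\<Sum>i<H. \<Sum>j<H. \<Sum>k<H. \<Sum>l<H. cis (real i * \<theta> + real j * \<theta> - real k * \<theta> - real l * \<theta>))"
      proof -
        have "sum a A * (sum a A * (sum b A * sum b A))
            = (\<Sum>i\<in>A. \<Sum>j\<in>A. \<Sum>k\<in>A. \<Sum>l\<in>A. a i * (a j * (b k * b l)))" for a b :: "nat \<Rightarrow> complex" and A
          by (simp flip: sum_distrib_left sum_distrib_right)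
        then show ?thesis
          unfolding cnjD unfolding D_def by (simp add: cis_mult diff_diff_eq algebra_simps)
      qed
      finally have "W\<^sup>2 = (\<Sum>i<H. \<Sum>j<H. \<Sum>k<H. \<Sum>l<H. cos (real i * \<theta> + real j * \<theta> - real k * \<theta> - real l * \<theta>))"
        by (simp add: complex_eq_iff)
      then show ?thesis
        by (simp add: X4_def f4_def sum.cartesian_product' algebra_simps)
    qed
    have id: "(1 - cos \<theta>) * W = 1 - cos (H * \<theta>)"
    proof -
      have norm_sq: "(cmod (1 - cis t))\<^sup>2 = 2 * (1 - cos t)" for t
        using sin_cos_squared_add[of t] by (simp add: cmod_power2 power2_diff)
      \<comment> \<open>A geometric sum; its squared moduli give the identity for
        \<open>W\<close>.\<close>
      have "(1 - cis \<theta>) * D = 1 - cis (H * \<theta>)"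
        unfolding D_def by (simp add: Complex.DeMoivre[symmetric] one_diff_power_eq)
      then have "(cmod (1 - cis \<theta>))\<^sup>2 * (cmod D)\<^sup>2 = (cmod (1 - cis (H * \<theta>)))\<^sup>2"
        by (metis norm_mult power_mult_distrib)
      then have "2 * ((1 - cos \<theta>) * W) = 2 * (1 - cos (H * \<theta>))"
        by (simp only: norm_sq W_def mult.assoc)
      then show ?thesis by (simp only: mult_cancel_left) simp
    qed
    have lt: "nat \<bar>f2 x\<bar> < 2 * H" "nat \<bar>f3 x\<bar> < 2 * H" if "x \<in> X2" for x
      using that by (auto simp: X2_def f2_def f3_def)
    have lt4: "nat \<bar>f4 x\<bar> < 2 * H" if "x \<in> X4" for x
      using that by (auto simp: X4_def f4_def)
    have R4: "(\<Sum>n<2*H. r4 n * cos (real n * \<theta>)) = W\<^sup>2"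
      unfolding r4_def WW by (rule sum_cos_int_regroup[OF fin(1) lt4, symmetric])
    have R2: "(\<Sum>n<2*H. r2 n * cos (real n * \<theta>)) = W"
      unfolding r2_def by (rule trans[OF sum_cos_int_regroup[OF fin(2) lt(1), symmetric] W2[symmetric]])
    have R3: "(\<Sum>n<2*H. r3 n * cos (real n * \<theta>)) = W * cos (H * \<theta>)"
      unfolding r3_def WH by (rule sum_cos_int_regroup[OF fin(2) lt(2), symmetric])
    have "(\<Sum>n<2*H. c n * cos (real n * \<theta>)) = \<kappa> * (\<Sum>n<2*H. r4 n * cos (real n * \<theta>))
        - (\<Sum>n<2*H. r2 n * cos (real n * \<theta>)) + (\<Sum>n<2*H. r3 n * cos (real n * \<theta>))"
      by (simp add: c_def algebra_simps sum.distrib sum_subtractf sum_distrib_left)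
    also have "\<dots> = \<kappa> * W\<^sup>2 - W + W * cos (H * \<theta>)" by (simp only: R4 R2 R3)
    \<comment> \<open>By \<open>id\<close>, \<open>1 - cos (H * \<theta>)\<close> is itself a
      multiple of \<open>W\<close>, so \<open>W\<^sup>2\<close> factors out and
      \<open>\<kappa> - (1 - cos \<theta>)\<close> decides the sign.\<close>
    also have "\<dots> = W * (\<kappa> * W - (1 - cos \<theta>) * W)"
      unfolding id by (simp add: algebra_simps power2_eq_square)
    also have "\<dots> = - (W\<^sup>2 * ((1 - cos \<theta>) - \<kappa>))"
      by (simp add: algebra_simps power2_eq_square)
    also have "\<dots> \<le> 0"
      using \<theta> by (simp add: \<kappa>_def)
    finally show ?thesis .
  qed
  ultimately show ?thesis by (intro that[of c])
qed

section \<open>The second moment on the unit cube\<close>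


lemma dist_int_ge_iff: "c \<le> dist_int x \<longleftrightarrow> (\<forall>k::int. c \<le> \<bar>x + of_int k\<bar>)"
  unfolding dist_int_def by (subst le_cINF_iff) (auto intro!: bdd_belowI[of _ 0])

lemma dist_int_le: "dist_int x \<le> \<bar>x + of_int k\<bar>"
  using dist_int_ge_iff[of "dist_int x" x] by blast

lemma dist_int_nonneg: "0 \<le> dist_int x"
  by (simp add: dist_int_ge_iff)

lemma dist_int_le_half: "dist_int x \<le> 1 / 2"
  using dist_int_le[of x "- round x"] of_int_round_abs_le[of x]
  by (simp add: abs_minus_commute)

lemma dist_int_add_of_int: "dist_int (x + of_int k) = dist_int x"
proof (rule antisym)
  show "dist_int (x + of_int k) \<le> dist_int x"
    unfolding dist_int_ge_iff
  proof
    fix j :: int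
    show "dist_int (x + of_int k) \<le> \<bar>x + of_int j\<bar>"
      using dist_int_le[of "x + of_int k" "j - k"] by simp
  qed
  show "dist_int x \<le> dist_int (x + of_int k)"
    unfolding dist_int_ge_iff
  proof
    fix j :: int
    show "dist_int x \<le> \<bar>x + of_int k + of_int j\<bar>"
      using dist_int_le[of x "k + j"] by (simp add: add.assoc)
  qed
qed

lemma dist_int_frac_diff: "dist_int (frac x - frac y) = dist_int (x - y)"
  using dist_int_add_of_int[of "x - y" "\<lfloor>y\<rfloor> - \<lfloor>x\<rfloor>"] by (simp add: frac_def algebra_simps)

text \<open>An intersection of closed sets over all integer shifts. It makes the exceptional sets
  compact, hence measurable with finite measure.\<close>

lemma closed_dist_int_ge: "closed {x. c \<le> dist_int x}"
proof -
  have "{x. c \<le> dist_int x} = (\<Inter>k::int. {x. c \<le> \<bar>x + of_int k\<bar>})"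
    by (auto simp: dist_int_ge_iff)
  also have "closed \<dots>"
    by (intro closed_INT ballI closed_Collect_le continuous_intros)
  finally show ?thesis .
qed

text \<open>The left side is \<open>2 * (sin y)\<^sup>2\<close> with
  \<open>y = pi * dist_int x\<close>. As \<open>y\<^sup>2 \<le> 3\<close>, the cubic Taylor bound
  gives \<open>sin y \<ge> y / 2\<close>, and \<open>pi\<^sup>2 \<ge> 8\<close> does the rest. The
  constant \<open>4\<close> is the one in the condition of \<open>cosine_minorant\<close>.\<close>

lemma one_minus_cos_ge_dist_int: "1 - cos (2 * pi * x) \<ge> 4 * (dist_int x)\<^sup>2"
proof -
  obtain k :: int where k: "dist_int x = \<bar>x + of_int k\<bar>"
    using dist_int_attained by blast
  define t where "t = dist_int x"
  define y where "y = pi * t"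
  have t: "0 \<le> t" "t \<le> 1 / 2" 
    using dist_int_nonneg[of x] dist_int_le_half[of x] by (simp_all add: t_def)
  have y0: "0 \<le> y" using t by (simp add: y_def)
  have "y \<le> 3.2 * (1 / 2)"
    unfolding y_def using t pi_approx by (intro mult_mono) auto
  then have "y\<^sup>2 \<le> 1.6\<^sup>2"
    using y0 by (intro power_mono) auto
  then have y2: "y\<^sup>2 \<le> 3" by (simp add: power2_eq_square)
  have "\<bar>sin y - y\<bar> \<le> y ^ 3 / 6"
    using Maclaurin_sin_bound[of y 3] y0
    by (simp add: sin_coeff_def eval_nat_numeral)
  moreover have "y ^ 3 \<le> 3 * y"
    using mult_right_mono[OF y2 y0] by (simp add: power2_eq_square power3_eq_cube)
  ultimately have "sin y \<ge> y / 2" by linarith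
  then have "(sin y)\<^sup>2 \<ge> (y / 2)\<^sup>2" using y0 by (intro power_mono) auto
  moreover have "(y / 2)\<^sup>2 \<ge> 2 * t\<^sup>2"
  proof -
    have "pi\<^sup>2 \<ge> 3\<^sup>2" using pi_gt3 by (intro power_mono) auto
    then have "t\<^sup>2 * pi\<^sup>2 \<ge> t\<^sup>2 * 8" by (intro mult_left_mono) auto
    then show ?thesis by (simp add: y_def power_mult_distrib power_divide mult.commute)
  qed
  ultimately have "4 * t\<^sup>2 \<le> 2 * (sin y)\<^sup>2" by linarith
  also have "\<dots> = 1 - cos (2 * y)" by (simp add: cos_double_sin)
  also have "cos (2 * y) = cos (2 * pi * x)"
  proof -
    have "cos (2 * y) = cos (2 * pi * (x + of_int k))"
    proof (cases "x + of_int k \<ge> 0")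
      case False
      then have "2 * y = - (2 * pi * (x + of_int k))" by (simp add: y_def t_def k algebra_simps)
      then show ?thesis by (simp only: cos_minus)
    qed (simp add: y_def t_def k mult.assoc)
    also have "\<dots> = cos (2 * pi * x + 2 * pi * of_int k)" by (simp add: algebra_simps)
    also have "\<dots> = cos (2 * pi * x)" by (simp add: cos_add)
    finally show ?thesis .
  qed
  finally show ?thesis by (simp add: t_def)
qed

section \<open>Orthogonality of cosines on the unit cube\<close>

lemma integral_unit_interval_cis:
  assumes "n \<in> \<int>"
  shows "(\<integral>t. indicator {0..1} t *\<^sub>R cis (2 * pi * (n * t)) \<partial>lborel) = (if n = 0 then 1 else 0)"
proof (cases "n = 0")
  case False
  define F where "F z = exp (\<i> * (2 * pi * n) * z) / (\<i> * (2 * pi * n))" for z :: complex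
  have "(\<integral>t. indicator {0..1} t *\<^sub>R cis (2 * pi * (n * t)) \<partial>lborel) = F (of_real 1) - F (of_real 0)"
  proof (rule integral_FTC_atLeastAtMost)
    fix x
    have "(F has_field_derivative exp (\<i> * (2 * pi * n) * of_real x)) (at (of_real x))"
      unfolding F_def[abs_def] by (rule derivative_eq_intros refl)+ (use False in simp_all)
    then show "((\<lambda>t. F (of_real t)) has_vector_derivative cis (2 * pi * (n * x))) (at x within {0..1})"
      by (intro has_vector_derivative_real_field) (simp add: cis_conv_exp mult_ac)
  qed (auto intro!: continuous_intros)
  also have "F (of_real 1) - F (of_real 0) = 0"
    using cis_multiple_2pi[OF assms] by (simp add: F_def cis_conv_exp mult_ac)
  finally show ?thesis using False by simp
qed simp

text \<open>The cosine is the real part of an exponential, which factors over the coordinates;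
  Fubini reduces the claim to the unit interval, and a nonzero \<open>k\<close> has a coordinate
  whose factor vanishes.\<close>

lemma integral_unit_cube_cos:
  fixes k :: "real ^ 'd"
  assumes "\<And>i. k $ i \<in> \<int>"
  shows "(\<integral>x. indicator (cbox 0 1) x * cos (2 * pi * (k \<bullet> x)) \<partial>lborel) = (if k = 0 then 1 else 0)"
proof -
  interpret product_sigma_finite "\<lambda>_ :: real ^ 'd. lborel :: real measure" ..
  define g :: "real ^ 'd \<Rightarrow> real \<Rightarrow> complex"
    where "g b t = indicator {0..1} t *\<^sub>R cis (2 * pi * ((k \<bullet> b) * t))" for b t
  have Basis_int: "k \<bullet> b \<in> \<int>" if "b \<in> Basis" for b
    using that assms by (auto simp: Basis_vec_def inner_axis)
  have g_int: "integrable lborel (g b)" for b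
    unfolding g_def[abs_def] by (intro borel_integrable_compact) (auto intro!: continuous_intros)
  have g_prod: "indicator (cbox 0 1) x *\<^sub>R cis (2 * pi * (k \<bullet> x)) = (\<Prod>b\<in>Basis. g b (x \<bullet> b))" for x
  proof -
    have "(\<Prod>b\<in>Basis. g b (x \<bullet> b)) = (\<Prod>b\<in>Basis. of_real (indicator {0..1} (x \<bullet> b)) * cis (2 * pi * ((k \<bullet> b) * (x \<bullet> b))))"
      by (simp add: g_def scaleR_conv_of_real)
    also have "\<dots> = of_real (\<Prod>b\<in>Basis. indicator {0..1} (x \<bullet> b)) * (\<Prod>b\<in>Basis. cis (2 * pi * ((k \<bullet> b) * (x \<bullet> b))))"
      by (simp add: prod.distrib)
    also have "(\<Prod>b\<in>(Basis :: (real ^ 'd) set). indicator {0..1 :: real} (x \<bullet> b)) = (indicator (cbox 0 1) x :: real)"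
    proof -
      have "(1 :: real ^ 'd) \<bullet> b = 1" if "b \<in> Basis" for b
        using that by (auto simp: Basis_vec_def inner_axis)
      then show ?thesis
        by (auto simp: indicator_def mem_box prod_zero_iff)
    qed
    also have "(\<Prod>b\<in>Basis. cis (2 * pi * ((k \<bullet> b) * (x \<bullet> b)))) = cis (\<Sum>b\<in>Basis. 2 * pi * ((k \<bullet> b) * (x \<bullet> b)))"
      by (induction rule: infinite_finite_induct) (auto simp: cis_mult)
    also have "(\<Sum>b\<in>Basis. 2 * pi * ((k \<bullet> b) * (x \<bullet> b))) = 2 * pi * (k \<bullet> x)"
      by (simp add: euclidean_inner[of k x] sum_distrib_left)
    finally show ?thesis by (simp add: scaleR_conv_of_real)
  qed
  have [measurable]: "g b \<in> borel_measurable borel" for b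
    using borel_measurable_integrable[OF g_int[of b]] by simp
  have "(\<integral>x. indicator (cbox 0 1) x *\<^sub>R cis (2 * pi * (k \<bullet> x)) \<partial>lborel) = (\<integral>x. (\<Prod>b\<in>Basis. g b (x \<bullet> b)) \<partial>lborel)"
    by (simp only: g_prod)
  also have "\<dots> = (\<integral>f. (\<Prod>b\<in>Basis. g b ((\<Sum>b\<in>Basis. f b *\<^sub>R b) \<bullet> b)) \<partial>(\<Pi>\<^sub>M b\<in>Basis. lborel))"
    by (subst lborel_eq, subst integral_distr) auto
  also have "\<dots> = (\<integral>f. (\<Prod>b\<in>Basis. g b (f b)) \<partial>(\<Pi>\<^sub>M b\<in>Basis. lborel))"
    by (intro Bochner_Integration.integral_cong prod.cong refl) (simp add: inner_sum_left_Basis)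
  also have "\<dots> = (\<Prod>b\<in>Basis. \<integral>t. g b t \<partial>lborel)"
    by (rule product_integral_prod) (auto intro: g_int)
  also have "\<dots> = (\<Prod>b\<in>Basis. if k \<bullet> b = 0 then 1 else 0)"
    by (intro prod.cong refl) (simp add: g_def integral_unit_interval_cis Basis_int)
  also have "\<dots> = (if k = 0 then 1 else 0)"
  proof (cases "k = 0")
    case False
    then obtain b where "b \<in> Basis" "k \<bullet> b \<noteq> 0" using euclidean_all_zero_iff[of k] by blast
    then show ?thesis using False by (auto simp: prod_zero_iff)
  qed simp
  finally have *: "(\<integral>x. indicator (cbox 0 1) x *\<^sub>R cis (2 * pi * (k \<bullet> x)) \<partial>lborel) = (if k = 0 then 1 else 0)" .
  have "integrable lborel (\<lambda>x. indicator (cbox 0 1) x *\<^sub>R cis (2 * pi * (k \<bullet> x)))"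
    by (intro borel_integrable_compact) (auto intro!: continuous_intros)
  from integral_Re[OF this] show ?thesis
    unfolding * by (simp split: if_splits)
qed


lemma integrable_unit_cube:
  fixes f :: "real ^ 'd \<Rightarrow> real"
  assumes "continuous_on UNIV f"
  shows "integrable lborel (\<lambda>x. indicator (cbox 0 1) x * f x)"
  using borel_integrable_compact[of "cbox 0 1" f] continuous_on_subset[OF assms] by simp

text \<open>Product-to-sum leaves the frequencies \<open>k - l\<close> and \<open>k + l\<close>; as
  \<open>k + l \<noteq> 0\<close>, only \<open>k = l\<close> gives a nonzero mean.\<close>

lemma integral_unit_cube_cos_mult_cos:
  fixes k l :: "real ^ 'd"
  assumes "\<And>i. k $ i \<in> \<int>" "\<And>i. l $ i \<in> \<int>" "k + l \<noteq> 0"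
  shows "(\<integral>x. indicator (cbox 0 1) x * (cos (2 * pi * (k \<bullet> x)) * cos (2 * pi * (l \<bullet> x))) \<partial>lborel)
       = (if k = l then 1 / 2 else 0)"
proof -
  let ?f = "\<lambda>k x. indicator (cbox 0 1) x * cos (2 * pi * (k \<bullet> x)) :: real"
  have int: "integrable lborel (?f k)" for k :: "real ^ 'd"
    by (intro integrable_unit_cube continuous_intros)
  have "indicator (cbox 0 1) x * (cos (2 * pi * (k \<bullet> x)) * cos (2 * pi * (l \<bullet> x)))
      = (1 / 2) * (?f (k - l) x + ?f (k + l) x)" for x
    by (simp add: cos_times_cos inner_diff_left inner_add_left algebra_simps)
  then have "(\<integral>x. indicator (cbox 0 1) x * (cos (2 * pi * (k \<bullet> x)) * cos (2 * pi * (l \<bullet> x))) \<partial>lborel)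
      = (1 / 2) * ((\<integral>x. ?f (k - l) x \<partial>lborel) + (\<integral>x. ?f (k + l) x \<partial>lborel))"
    by (simp only: integral_mult_right_zero Bochner_Integration.integral_add[OF int int])
  also have "(\<integral>x. ?f (k - l) x \<partial>lborel) = (if k = l then 1 else 0)"
    using assms by (subst integral_unit_cube_cos) auto
  also have "(\<integral>x. ?f (k + l) x \<partial>lborel) = 0"
    using assms by (subst integral_unit_cube_cos) auto
  finally show ?thesis by (cases "k = l") simp_all
qed

text \<open>In the expanded square a cross term survives only if
  \<open>real m *\<^sub>R v p = real n *\<^sub>R v q\<close>. Reading off coordinate
  \<open>i\<close> gives \<open>m * p = n * q\<close>: passing to one coordinate can only enlarge
  the count, which reduces the problem to dimension one.\<close>

lemma second_moment_le:
  fixes v :: "nat \<Rightarrow> real ^ 'd" and c :: "nat \<Rightarrow> real"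
  assumes V: "finite V" "0 \<notin> V" and L: "finite L" "0 \<notin> L" "L \<subseteq> {1..N}"
    and int: "\<And>p j. p \<in> V \<Longrightarrow> v p $ j \<in> \<int>"
    and proj: "\<And>p. p \<in> V \<Longrightarrow> v p $ i = real p"
    and c: "\<And>n. \<bar>c n\<bar> \<le> B"
  defines "G \<equiv> \<lambda>x. \<Sum>p\<in>V. \<Sum>n\<in>L. c n * cos (real n * (2 * pi * (v p \<bullet> x)))"
  shows "(\<integral>x. indicator (cbox 0 1) x * (G x)\<^sup>2 \<partial>lborel) \<le> B\<^sup>2 * card (mult_quads V N)"
proof -
  define e where "e = (\<lambda>(p, n) x. cos (2 * pi * ((real n *\<^sub>R v p) \<bullet> x)))"
  define I where "I z w = (\<integral>x. indicator (cbox 0 1) x * (e z x * e w x) \<partial>lborel)" for z w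
  let ?X = "V \<times> L"
  have G: "G x = (\<Sum>z\<in>?X. c (snd z) * e z x)" for x
    by (simp add: G_def e_def sum.cartesian_product mult_ac case_prod_beta)
  have cont: "continuous_on UNIV (\<lambda>x. e z x * e w x)" for z w
    by (auto simp: e_def case_prod_beta intro!: continuous_intros)
  have "indicator (cbox 0 1) x * (G x)\<^sup>2 = (\<Sum>z\<in>?X. \<Sum>w\<in>?X.
          (c (snd z) * c (snd w)) * (indicator (cbox 0 1) x * (e z x * e w x)))" for x
    by (simp add: G power2_eq_square sum_product sum_distrib_left mult_ac)
  then have "(\<integral>x. indicator (cbox 0 1) x * (G x)\<^sup>2 \<partial>lborel) = (\<Sum>z\<in>?X. \<Sum>w\<in>?X. (c (snd z) * c (snd w)) * I z w)"
    using integrable_unit_cube[OF cont] by (simp add: I_def)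
  also have "\<dots> \<le> (\<Sum>z\<in>?X. \<Sum>w\<in>?X. if snd z * fst z = snd w * fst w then B\<^sup>2 else 0)"
  proof (intro sum_mono)
    fix z w assume zw: "z \<in> ?X" "w \<in> ?X"
    obtain p m where z: "z = (p, m)" by fastforce
    obtain q n where w: "w = (q, n)" by fastforce
    have pos: "p > 0" "m > 0"
      using zw V L by (auto simp: z w intro!: gr0I)
    \<comment> \<open>Coordinate \<open>i\<close> is positive here, so two frequencies never add up
      to zero.\<close>
    have "(real m *\<^sub>R v p + real n *\<^sub>R v q) $ i = real (m * p + n * q)"
      using zw proj by (simp add: z w)
    then have ne: "real m *\<^sub>R v p + real n *\<^sub>R v q \<noteq> 0"
      using pos by (metis add_gr_0 mult_pos_pos of_nat_0_eq_iff not_less_zero zero_index)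
    have I: "I z w = (if real m *\<^sub>R v p = real n *\<^sub>R v q then 1 / 2 else 0)"
      unfolding I_def e_def z w prod.case using zw int ne
      by (intro integral_unit_cube_cos_mult_cos) (auto simp: z w)
    show "(c (snd z) * c (snd w)) * I z w \<le> (if snd z * fst z = snd w * fst w then B\<^sup>2 else 0)"
    proof (cases "real m *\<^sub>R v p = real n *\<^sub>R v q")
      case True
      then have "(real m *\<^sub>R v p) $ i = (real n *\<^sub>R v q) $ i" by simp
      then have eq: "m * p = n * q"
        using zw proj by (simp add: z w flip: of_nat_mult)
      have "c m * c n \<le> \<bar>c m\<bar> * \<bar>c n\<bar>"
        by (metis abs_ge_self abs_mult)
      also have "\<dots> \<le> B * B" using c[of m] c[of n] by (intro mult_mono) auto
      finally have "c m * c n * (1 / 2) \<le> B\<^sup>2"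
        using zero_le_square[of B] unfolding power2_eq_square by linarith
      moreover have "I z w = 1 / 2" by (simp only: I True refl if_True)
      ultimately show ?thesis using eq by (simp only: z w fst_conv snd_conv refl if_True)
    qed (use I[unfolded z w] in \<open>simp add: z w\<close>)
  qed
  also have "\<dots> = B\<^sup>2 * card {(z, w). z \<in> ?X \<and> w \<in> ?X \<and> snd z * fst z = snd w * fst w}"
  proof -
    let ?P = "\<lambda>y. snd (fst y) * fst (fst y) = snd (snd y) * fst (snd y)"
    have "(\<Sum>z\<in>?X. \<Sum>w\<in>?X. if snd z * fst z = snd w * fst w then B\<^sup>2 else 0)
        = (\<Sum>y\<in>?X \<times> ?X. if ?P y then B\<^sup>2 else 0)"
      unfolding sum.cartesian_product by (intro sum.cong refl) (simp add: case_prod_beta)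
    also have "\<dots> = (\<Sum>y\<in>{y \<in> ?X \<times> ?X. ?P y}. B\<^sup>2)"
      using V L by (intro sum.inter_filter[symmetric]) simp
    also have "{y \<in> ?X \<times> ?X. ?P y} = {(z, w). z \<in> ?X \<and> w \<in> ?X \<and> snd z * fst z = snd w * fst w}"
      by auto
    finally show ?thesis by (simp add: mult.commute)
  qed
  also have "\<dots> \<le> B\<^sup>2 * card (mult_quads V N)"
  proof (intro mult_left_mono)
    have "card {(z, w). z \<in> ?X \<and> w \<in> ?X \<and> snd z * fst z = snd w * fst w} \<le> card (mult_quads V N)"
      using L(3) finite_mult_quads[OF V(1)]
      by (intro card_inj_on_le[where f = "\<lambda>((p, m), (q, n)). (p, q, m, n)"])
         (auto simp: inj_on_def mult_quads_def)
    then show "real (card {(z, w). z \<in> ?X \<and> w \<in> ?X \<and> snd z * fst z = snd w * fst w}) \<le> real (card (mult_quads V N))"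
      by simp
  qed simp
  finally show ?thesis .
qed

lemma closed_dist_int_inner_ge: "closed {x :: 'a :: real_inner. c \<le> dist_int (k \<bullet> x)}"
  using closed_vimage[OF closed_dist_int_ge[of c], of "\<lambda>x. k \<bullet> x"]
  by (simp add: vimage_def continuous_intros)

text \<open>Chebyshev: on \<open>S\<close> each \<open>p\<close> contributes at most
  \<open>- real H\<close> to \<open>G\<close>, so \<open>(G x)\<^sup>2\<close> is at least
  \<open>(card V * H)\<^sup>2\<close>, while its integral is at most \<open>(12 * H)\<^sup>2\<close>
  times the number of quadruples. The factor \<open>H\<^sup>2\<close> cancels.\<close>

lemma measure_all_dist_int_ge_le:
  fixes v :: "nat \<Rightarrow> real ^ 'd"
  assumes V: "finite V" "0 \<notin> V" and H: "H > 0"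
    and int: "\<And>p j. p \<in> V \<Longrightarrow> v p $ j \<in> \<int>"
    and proj: "\<And>p. p \<in> V \<Longrightarrow> v p $ i = real p"
  defines "S \<equiv> {x \<in> cbox 0 1. \<forall>p\<in>V. 1 / real H \<le> dist_int (v p \<bullet> x)}"
  shows "measure lborel S * (real (card V))\<^sup>2 \<le> 144 * real (card (mult_quads V (2 * H)))"
proof -
  obtain c :: "nat \<Rightarrow> real" where c0: "c 0 \<ge> real H" and c: "\<And>n. \<bar>c n\<bar> \<le> 12 * real H"
    and minorant: "\<And>\<theta>. 1 - cos \<theta> \<ge> 4 / (real H)\<^sup>2 \<Longrightarrow> (\<Sum>n<2*H. c n * cos (real n * \<theta>)) \<le> 0"
    using cosine_minorant[OF H] by blast
  \<comment> \<open>Frequency \<open>0\<close> is left out, so \<open>G\<close> is the sum of the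
    minorants without their constant terms \<open>c 0\<close>.\<close>
  define L where "L = {1..<2 * H}"
  define G where "G x = (\<Sum>p\<in>V. \<Sum>n\<in>L. c n * cos (real n * (2 * pi * (v p \<bullet> x))))" for x
  have S: "S = cbox 0 1 \<inter> (\<Inter>p\<in>V. {x. 1 / real H \<le> dist_int (v p \<bullet> x)})"
    by (auto simp: S_def)
  have clS: "closed S"
    unfolding S by (intro closed_Int closed_INT ballI closed_dist_int_inner_ge closed_cbox)
  have cS: "compact S"
    using clS by (intro compact_eq_bounded_closed[THEN iffD2] conjI bounded_subset[OF bounded_cbox]) (auto simp: S_def)
  have lower: "(real (card V) * real H)\<^sup>2 \<le> (G x)\<^sup>2" if x: "x \<in> S" for x
  proof -
    have "(\<Sum>n\<in>L. c n * cos (real n * (2 * pi * (v p \<bullet> x)))) \<le> - real H" if p: "p \<in> V" for p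
    proof -
      have "(1 / real H)\<^sup>2 \<le> (dist_int (v p \<bullet> x))\<^sup>2"
        using x p by (intro power_mono) (auto simp: S_def)
      then have "4 / (real H)\<^sup>2 \<le> 1 - cos (2 * pi * (v p \<bullet> x))"
        using one_minus_cos_ge_dist_int[of "v p \<bullet> x"] by (simp add: power_divide)
      from minorant[OF this] have "(\<Sum>n<2*H. c n * cos (real n * (2 * pi * (v p \<bullet> x)))) \<le> 0" .
      moreover have "{..<2*H} = insert 0 L" using H by (auto simp: L_def)
      ultimately show ?thesis using c0 by (simp add: L_def)
    qed
    then have "G x \<le> (\<Sum>p\<in>V. - real H)" unfolding G_def by (rule sum_mono)
    then have "real (card V) * real H \<le> \<bar>G x\<bar>" by simp
    then have "(real (card V) * real H)\<^sup>2 \<le> \<bar>G x\<bar>\<^sup>2" by (intro power_mono) auto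
    then show ?thesis by simp
  qed
  have "measure lborel S * (real (card V) * real H)\<^sup>2
      = (\<integral>x. indicator S x * (real (card V) * real H)\<^sup>2 \<partial>lborel)"
    using clS emeasure_compact_finite[OF cS] by (simp add: borel_closed)
  also have "\<dots> \<le> (\<integral>x. indicator (cbox 0 1) x * (G x)\<^sup>2 \<partial>lborel)"
  proof (rule integral_mono)
    show "integrable lborel (\<lambda>x. indicator S x * (real (card V) * real H)\<^sup>2)"
      using clS emeasure_compact_finite[OF cS] by (simp add: borel_closed)
    show "integrable lborel (\<lambda>x. indicator (cbox 0 1) x * (G x)\<^sup>2)"
      unfolding G_def by (intro integrable_unit_cube continuous_intros)
    show "indicator S x * (real (card V) * real H)\<^sup>2 \<le> indicator (cbox 0 1) x * (G x)\<^sup>2" for x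
      using lower[of x] by (auto simp: indicator_def S_def)
  qed
  also have "\<dots> \<le> (12 * real H)\<^sup>2 * card (mult_quads V (2 * H))"
    unfolding G_def
    by (rule second_moment_le[OF V _ _ _ int proj c]) (auto simp: L_def)
  finally have "(measure lborel S * (real (card V))\<^sup>2) * (real H)\<^sup>2
      \<le> (144 * real (card (mult_quads V (2 * H)))) * (real H)\<^sup>2"
    by (simp add: power_mult_distrib mult_ac)
  then show ?thesis using H by (simp add: mult_le_cancel_right)
qed

section \<open>Differences and the exceptional set\<close>


text \<open>The larger index comes first, so that the truncated subtraction in
  \<open>differences\<close> is exact for increasing sequences.\<close>

definition increasing_pairs :: "nat \<Rightarrow> (nat \<times> nat) set" where
  "increasing_pairs N = (SIGMA n:{1..N}. {1..<n})"

definition differences :: "(nat \<Rightarrow> nat) \<Rightarrow> nat \<Rightarrow> nat set" where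
  "differences b N = (\<lambda>(n, m). b n - b m) ` increasing_pairs N"

lemma finite_increasing_pairs: "finite (increasing_pairs N)"
  by (simp add: increasing_pairs_def)

lemma card_increasing_pairs: "2 * card (increasing_pairs N) + N = N\<^sup>2"
proof -
  have "card (increasing_pairs N) = (\<Sum>n=1..N. n - 1)"
    by (simp add: increasing_pairs_def)
  also have "2 * \<dots> + N = N\<^sup>2"
    by (induction N) (auto simp: power2_eq_square)
  finally show ?thesis .
qed

lemma finite_differences: "finite (differences b N)"
  by (simp add: differences_def finite_increasing_pairs)

lemma card_differences_le: "card (differences b N) \<le> N\<^sup>2"
proof -
  have "card (differences b N) \<le> card (increasing_pairs N)"
    unfolding differences_def by (rule card_image_le[OF finite_increasing_pairs])
  then show ?thesis using card_increasing_pairs[of N] by linarith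
qed

lemma increasing_pairs_less:
  assumes "strict_mono_on {1..} b" "(n, m) \<in> increasing_pairs N"
  shows "b m < b n"
  using assms by (auto simp: increasing_pairs_def intro: strict_mono_onD)

lemma zero_notin_differences:
  assumes "strict_mono_on {1..} b"
  shows "0 \<notin> differences b N"
  using increasing_pairs_less[OF assms] by (fastforce simp: differences_def)

text \<open>Equal differences \<open>b n - b m = b n' - b m'\<close> rearrange to
  \<open>b n + b m' = b n' + b m\<close>, so collisions of the difference map inject into the
  additive quadruples, and Cauchy-Schwarz applies.\<close>

lemma card_differences_mult_additive_energy_ge:
  assumes b: "strict_mono_on {1..} b" and N: "N \<ge> 2"
  shows "N ^ 4 \<le> 16 * card (differences b N) * additive_energy b N"
proof -
  let ?S = "increasing_pairs N" and ?f = "\<lambda>(n, m). b n - b m"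
  let ?E = "{(n1, n2, n3, n4). n1 \<in> {1..N} \<and> n2 \<in> {1..N} \<and> n3 \<in> {1..N} \<and> n4 \<in> {1..N} \<and>
             b n1 + b n2 = b n3 + b n4}"
  have finE: "finite ?E"
    by (rule finite_subset[of _ "{1..N} \<times> {1..N} \<times> {1..N} \<times> {1..N}"]) auto
  have sub: "n \<in> {1..N} \<and> m \<in> {1..N}" if "(n, m) \<in> ?S" for n m
    using that by (auto simp: increasing_pairs_def)
  have "card {(x, y). x \<in> ?S \<and> y \<in> ?S \<and> ?f x = ?f y} \<le> card ?E"
  proof (rule card_inj_on_le[OF _ _ finE])
    show "inj_on (\<lambda>((n, m), (n', m')). (n, m', n', m)) {(x, y). x \<in> ?S \<and> y \<in> ?S \<and> ?f x = ?f y}"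
      by (auto simp: inj_on_def)
    show "(\<lambda>((n, m), (n', m')). (n, m', n', m)) ` {(x, y). x \<in> ?S \<and> y \<in> ?S \<and> ?f x = ?f y} \<subseteq> ?E"
    proof (rule image_subsetI)
      fix z assume "z \<in> {(x, y). x \<in> ?S \<and> y \<in> ?S \<and> ?f x = ?f y}"
      then obtain n m n' m' where z: "z = ((n, m), (n', m'))" "(n, m) \<in> ?S" "(n', m') \<in> ?S"
        and eq: "b n - b m = b n' - b m'"
        by auto
      have "b n + b m' = b n' + b m"
        using eq increasing_pairs_less[OF b z(2)] increasing_pairs_less[OF b z(3)] by linarith
      then show "(\<lambda>((n, m), (n', m')). (n, m', n', m)) z \<in> ?E"
        using sub[OF z(2)] sub[OF z(3)] by (simp add: z(1))
    qed
  qed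
  then have "card {(x, y). x \<in> ?S \<and> y \<in> ?S \<and> ?f x = ?f y} \<le> additive_energy b N"
    by (simp add: additive_energy_def)
  then have le: "(card ?S)\<^sup>2 \<le> card (differences b N) * additive_energy b N"
    using card_square_le_card_image_mult_card_collisions[OF finite_increasing_pairs, of N ?f]
    by (simp add: differences_def) (meson mult_le_mono2 order_trans)
  \<comment> \<open>At least a quarter of all \<open>N\<^sup>2\<close> pairs are increasing;
    squaring this \<open>4\<close> gives the \<open>16\<close>.\<close>
  have "2 * N \<le> N\<^sup>2" using N by (simp add: power2_eq_square)
  then have "N\<^sup>2 \<le> 4 * card ?S"
    using card_increasing_pairs[of N] by linarith
  then have "(N\<^sup>2)\<^sup>2 \<le> (4 * card ?S)\<^sup>2"
    by (rule power_mono) simp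
  also have "\<dots> = 16 * (card ?S)\<^sup>2" by (simp add: power_mult_distrib)
  also have "\<dots> \<le> 16 * (card (differences b N) * additive_energy b N)"
    using le by simp
  finally show ?thesis by (simp flip: power_mult)
qed

section \<open>The exceptional set\<close>

definition coord_vec :: "('d::finite \<Rightarrow> nat \<Rightarrow> nat) \<Rightarrow> nat \<Rightarrow> real ^ 'd" where
  "coord_vec a n = (\<chi> i. real (a i n))"

text \<open>The event that no two of the first \<open>N\<close> points are closer than
  \<open>1 / H\<close>, phrased by difference vectors instead of fractional parts so that it is
  visibly closed.\<close>

definition gap_ge_set :: "('d::finite \<Rightarrow> nat \<Rightarrow> nat) \<Rightarrow> nat \<Rightarrow> nat \<Rightarrow> (real ^ 'd) set" where
  "gap_ge_set a N H = {x \<in> cbox 0 1. \<forall>(n, m)\<in>increasing_pairs N.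
     1 / real H \<le> dist_int ((coord_vec a n - coord_vec a m) \<bullet> x)}"

lemma compact_cbox_dist_int_ge:
  "compact {x \<in> cbox 0 (1 :: real ^ 'd). \<forall>p\<in>P. c \<le> dist_int (w p \<bullet> x)}"
proof -
  have "{x \<in> cbox 0 (1 :: real ^ 'd). \<forall>p\<in>P. c \<le> dist_int (w p \<bullet> x)}
      = cbox 0 1 \<inter> (\<Inter>p\<in>P. {x. c \<le> dist_int (w p \<bullet> x)})"
    by auto
  then show ?thesis
    by (simp only:) (intro compact_Int_closed compact_cbox closed_INT ballI closed_dist_int_inner_ge)
qed

lemma compact_gap_ge_set: "compact (gap_ge_set a N H)"
  using compact_cbox_dist_int_ge[of "increasing_pairs N" "1 / real H" "\<lambda>p. coord_vec a (fst p) - coord_vec a (snd p)"]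
  by (simp add: gap_ge_set_def case_prod_beta)

text \<open>One pair \<open>r p\<close> is chosen for each value \<open>p\<close> of the difference
  in coordinate \<open>i\<close>. Keeping only these conditions enlarges the exceptional set to
  \<open>S\<close>, and the chosen vectors have \<open>p\<close> as coordinate
  \<open>i\<close>.\<close>

lemma measure_gap_ge_set_le:
  assumes a: "strict_mono_on {1..} (a i)" and H: "H > 0"
  shows "measure lborel (gap_ge_set a N H) * (real (card (differences (a i) N)))\<^sup>2
    \<le> 144 * real (card (mult_quads (differences (a i) N) (2 * H)))"
proof -
  let ?V = "differences (a i) N"
  have "\<forall>p\<in>?V. \<exists>z\<in>increasing_pairs N. p = a i (fst z) - a i (snd z)"
    by (auto simp: differences_def) (metis fst_conv snd_conv)
  then obtain r where r: "\<And>p. p \<in> ?V \<Longrightarrow> r p \<in> increasing_pairs N"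
    "\<And>p. p \<in> ?V \<Longrightarrow> p = a i (fst (r p)) - a i (snd (r p))"
    by metis
  define v where "v p = coord_vec a (fst (r p)) - coord_vec a (snd (r p))" for p
  define S where "S = {x \<in> cbox 0 1. \<forall>p\<in>?V. 1 / real H \<le> dist_int (v p \<bullet> x)}"
  have "gap_ge_set a N H \<subseteq> S"
    using r(1) by (force simp: gap_ge_set_def S_def v_def case_prod_beta)
  moreover have "compact S"
    unfolding S_def by (rule compact_cbox_dist_int_ge)
  ultimately have "measure lborel (gap_ge_set a N H) \<le> measure lborel S"
    using compact_gap_ge_set[of a N H] emeasure_compact_finite[of S]
    by (intro measure_mono_fmeasurable) (auto simp: fmeasurable_def borel_compact)
  then have "measure lborel (gap_ge_set a N H) * (real (card ?V))\<^sup>2 \<le> measure lborel S * (real (card ?V))\<^sup>2"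
    by (rule mult_right_mono) simp
  also have "\<dots> \<le> 144 * real (card (mult_quads ?V (2 * H)))"
    unfolding S_def
  proof (rule measure_all_dist_int_ge_le[OF finite_differences zero_notin_differences[OF a] H])
    show "v p $ j \<in> \<int>" for p j
      by (simp add: v_def coord_vec_def)
    show "v p $ i = real p" if "p \<in> ?V" for p
    proof -
      have "a i (snd (r p)) < a i (fst (r p))"
        using increasing_pairs_less[OF a] r(1)[OF that] by (metis prod.collapse)
      then show ?thesis
        using r(2)[OF that] by (simp add: v_def coord_vec_def)
    qed
  qed
  finally show ?thesis .
qed

text \<open>A close pair among the first \<open>M\<close> points is still present among the first
  \<open>N\<close>; this allows \<open>M\<close> to be restricted to powers of two.\<close>

lemma min_gap_frac_dot_less:
  fixes a :: "'d::finite \<Rightarrow> nat \<Rightarrow> nat"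
  assumes "x \<in> cbox 0 1" "x \<notin> gap_ge_set a M H" "M \<le> N"
  shows "min_gap (frac_dot a x) N < 1 / real H"
proof -
  obtain n m where nm: "(n, m) \<in> increasing_pairs M"
    and less: "dist_int ((coord_vec a n - coord_vec a m) \<bullet> x) < 1 / real H"
    using assms(1,2) by (force simp: gap_ge_set_def)
  let ?D = "{dist_int (frac_dot a x n - frac_dot a x m) | n m. n \<in> {1..N} \<and> m \<in> {1..N} \<and> n \<noteq> m}"
  have "?D \<subseteq> (\<lambda>(n, m). dist_int (frac_dot a x n - frac_dot a x m)) ` ({1..N} \<times> {1..N})"
    by auto
  then have "finite ?D" by (rule finite_subset) simp
  moreover have "dist_int (frac_dot a x n - frac_dot a x m) \<in> ?D"
    using nm assms(3) by (force simp: increasing_pairs_def)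
  ultimately have "min_gap (frac_dot a x) N \<le> dist_int (frac_dot a x n - frac_dot a x m)"
    unfolding min_gap_def by (rule Min_le)
  also have "\<dots> = dist_int ((coord_vec a n - coord_vec a m) \<bullet> x)"
    by (simp add: frac_dot_def dist_int_frac_diff coord_vec_def inner_diff_left)
  finally show ?thesis using less by simp
qed

text \<open>With \<open>M\<close> the number of differences, the Chebyshev bound is of size
  \<open>H / M\<close> up to small powers. The energy hypothesis makes \<open>M\<close> nearly
  \<open>N\<^sup>2\<close>, whereas \<open>H\<close> is only about
  \<open>N powr (2 - \<delta> / 2)\<close>.\<close>

lemma measure_gap_ge_set_decay:
  fixes a :: "'d::finite \<Rightarrow> nat \<Rightarrow> nat"
  assumes mono: "\<And>i. strict_mono_on {1..} (a i)"
    and energy: "\<And>\<eta>::real. \<eta> > 0 \<Longrightarrow>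
      (\<lambda>N. real (MIN i. additive_energy (a i) N)) \<in> O(\<lambda>N. real N powr (2 + \<eta>))"
    and \<delta>: "0 < \<delta>" "\<delta> \<le> 1"
  obtains K where "K > 0" "\<forall>\<^sub>F N in sequentially.
    measure lborel (gap_ge_set a N (nat \<lceil>real N powr (2 - \<delta> / 2)\<rceil>)) \<le> K * real N powr (- \<delta> / 4)"
proof -
  \<comment> \<open>The losses \<open>2 * \<rho> + s * \<rho> + \<eta>\<close> are at most
    \<open>4 * \<rho> + \<eta> = 3 * \<delta> / 16\<close>, below the \<open>\<delta> / 4\<close>
    left between the saving \<open>\<delta> / 2\<close> in \<open>H\<close> and the claimed
    decay.\<close>
  define \<rho> where "\<rho> = \<delta> / 32"
  define \<eta> where "\<eta> = \<delta> / 16"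
  define s where "s = 2 - \<delta> / 2"
  have pos: "\<rho> > 0" "\<eta> > 0" using \<delta> by (simp_all add: \<rho>_def \<eta>_def)
  obtain C where C: "C > 0" "\<And>V L. finite V \<Longrightarrow> 0 \<notin> V \<Longrightarrow> L > 0 \<Longrightarrow>
    real (card (mult_quads V L)) \<le> C * real (card V) powr (1 + \<rho>) * real L powr (1 + \<rho>)"
    using card_mult_quads_le[OF pos(1)] by blast
  obtain B where B: "B > 0" "\<forall>\<^sub>F N in sequentially.
      real (MIN i. additive_energy (a i) N) \<le> B * real N powr (2 + \<eta>)"
    using landau_o.bigE[OF energy[OF pos(2)]] by (simp; metis)
  define K where "K = 16 * B * (144 * C * 16)"
  have "measure lborel (gap_ge_set a N (nat \<lceil>real N powr s\<rceil>)) \<le> K * real N powr (- \<delta> / 4)"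
    if N: "N \<ge> 2" and BN: "real (MIN i. additive_energy (a i) N) \<le> B * real N powr (2 + \<eta>)" for N
  proof -
    define H where "H = nat \<lceil>real N powr s\<rceil>"
    have N1: "1 \<le> real N" using N by simp
    \<comment> \<open>The minimizing \<open>i\<close> may change with \<open>N\<close>; neither the
      exceptional set nor the constants \<open>B\<close> and \<open>C\<close> depend on it.\<close>
    have "(MIN i. additive_energy (a i) N) \<in> range (\<lambda>i. additive_energy (a i) N)"
      by (intro Min_in) auto
    then obtain i where i: "(MIN i. additive_energy (a i) N) = additive_energy (a i) N"
      by (rule rangeE)
    define V where "V = differences (a i) N"
    define M where "M = real (card V)"
    define \<mu> where "\<mu> = measure lborel (gap_ge_set a N H)"
    have "real (N ^ 4) \<le> real (16 * card V * additive_energy (a i) N)"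
      unfolding V_def of_nat_le_iff by (rule card_differences_mult_additive_energy_ge[OF mono N])
    also have "\<dots> \<le> 16 * M * (B * real N powr (2 + \<eta>))"
      using BN unfolding i by (simp add: M_def mult_left_mono)
    finally have E: "real N powr 4 \<le> 16 * B * M * real N powr (2 + \<eta>)"
      using N by (simp add: mult_ac powr_numeral)
    have M_low: "real N powr (2 - \<eta>) \<le> 16 * B * M"
    proof -
      have "real N powr (2 - \<eta>) * real N powr (2 + \<eta>) \<le> (16 * B * M) * real N powr (2 + \<eta>)"
        using E by (simp flip: powr_add)
      then show ?thesis using N by simp
    qed
    moreover have "0 < real N powr (2 - \<eta>)" using N by simp
    ultimately have "0 < 16 * B * M" by linarith
    then have Mpos: "M > 0"
      using B(1) by (simp add: zero_less_mult_iff)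
    have M_up: "M powr \<rho> \<le> real N powr (2 * \<rho>)"
    proof -
      have "M \<le> real (N\<^sup>2)" unfolding M_def V_def of_nat_le_iff by (rule card_differences_le)
      then have "M \<le> real N powr 2" using N by (simp add: powr_numeral)
      then have "M powr \<rho> \<le> (real N powr 2) powr \<rho>"
        using pos Mpos by (intro powr_mono2) auto
      then show ?thesis by (simp only: powr_powr)
    qed
    have Ns: "1 \<le> real N powr s" using N1 \<delta> by (intro ge_one_powr_ge_zero) (auto simp: s_def)
    then have Hpos: "H > 0" using N by (simp add: H_def)
    have "real H \<le> 2 * real N powr s"
      unfolding H_def using Ns by linarith
    then have "real (2 * H) powr (1 + \<rho>) \<le> (4 * real N powr s) powr (1 + \<rho>)"
      using pos by (intro powr_mono2) auto
    also have "\<dots> = 4 powr (1 + \<rho>) * real N powr (s * (1 + \<rho>))"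
      by (simp add: powr_mult powr_powr)
    also have "(4 :: real) powr (1 + \<rho>) \<le> 4 powr 2"
      using \<delta> by (intro powr_mono) (auto simp: \<rho>_def)
    finally have H_up: "real (2 * H) powr (1 + \<rho>) \<le> 16 * real N powr (s * (1 + \<rho>))"
      by (simp add: mult_right_mono)
    have "\<mu> * M\<^sup>2 \<le> 144 * real (card (mult_quads V (2 * H)))"
      unfolding \<mu>_def M_def V_def by (rule measure_gap_ge_set_le[of a, OF mono Hpos])
    also have "\<dots> \<le> 144 * (C * M powr (1 + \<rho>) * real (2 * H) powr (1 + \<rho>))"
      unfolding M_def V_def using Hpos
      by (intro mult_left_mono C(2) finite_differences zero_notin_differences mono) auto
    \<comment> \<open>One factor \<open>M\<close> cancels. The surplus \<open>M powr \<rho>\<close>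
      needs only the trivial upper bound on \<open>M\<close>; the \<open>M\<close> remaining on the
      left is bounded below by the energy.\<close>
    also have "\<dots> = (144 * C * (M powr \<rho> * real (2 * H) powr (1 + \<rho>))) * M"
      using Mpos by (simp add: powr_add)
    finally have "\<mu> * M \<le> 144 * C * (M powr \<rho> * real (2 * H) powr (1 + \<rho>))"
      using Mpos by (simp add: power2_eq_square flip: mult.assoc)
    also have "\<dots> \<le> 144 * C * (real N powr (2 * \<rho>) * (16 * real N powr (s * (1 + \<rho>))))"
      using C(1) M_up H_up by (intro mult_left_mono mult_mono) auto
    also have "\<dots> = 144 * C * 16 * real N powr (2 * \<rho> + s * (1 + \<rho>))"
      by (simp add: powr_add)
    finally have \<mu>M: "\<mu> * M \<le> 144 * C * 16 * real N powr (2 * \<rho> + s * (1 + \<rho>))" .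
    have "\<mu> * real N powr (2 - \<eta>) \<le> \<mu> * (16 * B * M)"
      using M_low by (intro mult_left_mono) (auto simp: \<mu>_def)
    also have "\<dots> = 16 * B * (\<mu> * M)" by simp
    also have "\<dots> \<le> 16 * B * (144 * C * 16 * real N powr (2 * \<rho> + s * (1 + \<rho>)))"
      using B(1) \<mu>M by (intro mult_left_mono) auto
    also have "\<dots> = K * real N powr (2 * \<rho> + s * (1 + \<rho>))" by (simp add: K_def)
    also have "\<dots> \<le> K * real N powr (- \<delta> / 4 + (2 - \<eta>))"
    proof (intro mult_left_mono powr_mono N1)
      have "0 \<le> \<delta> * \<delta>" by simp
      then show "2 * \<rho> + s * (1 + \<rho>) \<le> - \<delta> / 4 + (2 - \<eta>)"
        using \<delta> by (simp add: \<rho>_def s_def \<eta>_def algebra_simps)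
    qed (use B C in \<open>simp add: K_def\<close>)
    also have "\<dots> = (K * real N powr (- \<delta> / 4)) * real N powr (2 - \<eta>)"
      unfolding powr_add by simp
    finally have "\<mu> \<le> K * real N powr (- \<delta> / 4)"
      using N by simp
    then show ?thesis by (simp add: \<mu>_def H_def)
  qed
  then have "\<forall>\<^sub>F N in sequentially. measure lborel (gap_ge_set a N (nat \<lceil>real N powr s\<rceil>)) \<le> K * real N powr (- \<delta> / 4)"
    by (intro eventually_mono[OF eventually_conj[OF eventually_ge_at_top[of 2] B(2)]]) auto
  moreover have "K > 0" using B(1) C(1) by (simp add: K_def)
  ultimately show ?thesis unfolding s_def by (intro that)
qed

section \<open>Borel-Cantelli along powers of two\<close>

lemma AE_min_gap_le:
  fixes a :: "'d::finite \<Rightarrow> nat \<Rightarrow> nat"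
  assumes mono: "\<And>i. strict_mono_on {1..} (a i)"
    and energy: "\<And>\<eta>::real. \<eta> > 0 \<Longrightarrow>
      (\<lambda>N. real (MIN i. additive_energy (a i) N)) \<in> O(\<lambda>N. real N powr (2 + \<eta>))"
    and \<delta>: "0 < \<delta>" "\<delta> \<le> 1"
  shows "AE x in lborel. x \<in> cbox 0 1 \<longrightarrow>
    (\<forall>\<^sub>F N in sequentially. min_gap (frac_dot a x) N \<le> real N powr \<delta> / real N ^ 2)"
proof -
  define s where "s = 2 - \<delta> / 2"
  define H where "H N = nat \<lceil>real N powr s\<rceil>" for N :: nat
  define A where "A k = gap_ge_set a (2 ^ k) (H (2 ^ k))" for k
  obtain K where K: "K > 0" "\<forall>\<^sub>F N in sequentially.
    measure lborel (gap_ge_set a N (H N)) \<le> K * real N powr (- \<delta> / 4)"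
    using measure_gap_ge_set_decay[of a, OF mono energy \<delta>] unfolding H_def s_def by blast
  have "filterlim (\<lambda>k::nat. (2::nat) ^ k) at_top sequentially"
    by (intro filterlim_subseq) (simp add: strict_mono_def)
  from eventually_compose_filterlim[OF K(2) this]
  have ev: "\<forall>\<^sub>F k in sequentially. norm (measure lborel (A k)) \<le> K * (2 powr (- \<delta> / 4)) ^ k"
  proof (rule eventually_mono)
    fix k :: nat
    have "real (2 ^ k) powr (- \<delta> / 4) = (2 powr (- \<delta> / 4)) ^ k"
      by (simp add: powr_powr mult.commute flip: powr_realpow)
    then show "measure lborel (gap_ge_set a (2 ^ k) (H (2 ^ k))) \<le> K * real (2 ^ k) powr (- \<delta> / 4) \<Longrightarrow>
       norm (measure lborel (A k)) \<le> K * (2 powr (- \<delta> / 4)) ^ k"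
      by (simp add: A_def)
  qed
  have "(2 :: real) powr (- \<delta> / 4) < 1"
    using \<delta> by (simp add: powr_less_one)
  then have "summable (\<lambda>k. K * (2 powr (- \<delta> / 4)) ^ k)"
    by (intro summable_mult summable_geometric) simp
  from summable_comparison_test_ev[OF ev this]
  have "summable (\<lambda>k. measure lborel (A k))" .
  then have "AE x in lborel. \<forall>\<^sub>F k in sequentially. x \<in> space lborel - A k"
    using compact_gap_ge_set[of a] emeasure_compact_finite
    by (intro borel_cantelli_AE1) (auto simp: A_def borel_compact)
  then show ?thesis
  proof (rule AE_mp, intro AE_I2 impI)
    fix x :: "real ^ 'd"
    assume "\<forall>\<^sub>F k in sequentially. x \<in> space lborel - A k" and x: "x \<in> cbox 0 1"
    then obtain k0 where k0: "\<And>k. k \<ge> k0 \<Longrightarrow> x \<notin> A k"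
      by (auto simp: eventually_sequentially)
    \<comment> \<open>Comparing \<open>N\<close> with the power of two below it costs a factor
      \<open>2 powr s \<le> 4\<close>. The threshold \<open>4 powr (2 / \<delta>)\<close> makes
      \<open>N powr (\<delta> / 2)\<close> at least \<open>4\<close>, so this half of the allowed
      power absorbs the loss.\<close>
    have le: "min_gap (frac_dot a x) N \<le> real N powr \<delta> / real N ^ 2"
      if N: "N \<ge> 2 ^ k0" "real N \<ge> 4 powr (2 / \<delta>)" for N
    proof -
      have N0: "N > 0" using N(1) by (metis gr0I le_zero_eq power_not_zero zero_neq_numeral)
      obtain k where k: "2 ^ k \<le> N" "N < 2 ^ (k + 1)"
        using ex_power_ivl1[of 2 N] N0 by auto
      have "(2 :: nat) ^ k0 < 2 ^ (k + 1)" using N k by linarith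
      then have "k0 < k + 1" by (rule power_less_imp_less_exp[rotated]) simp
      then have "k \<ge> k0" by simp
      then have "min_gap (frac_dot a x) N < 1 / real (H (2 ^ k))"
        using min_gap_frac_dot_less[OF x _ k(1)] k0 by (simp add: A_def)
      also have "\<dots> \<le> 1 / (2 ^ k) powr s"
        unfolding H_def by (intro divide_left_mono) (auto intro!: mult_pos_pos simp: zero_less_ceiling real_nat_ceiling_ge)
      also have "\<dots> \<le> 1 / (real N / 2) powr s"
      proof -
        have "real N < real (2 ^ (k + 1))" using k(2) by (simp only: of_nat_less_iff)
        then have "(real N / 2) powr s \<le> (2 ^ k) powr s"
          using \<delta> by (intro powr_mono2) (auto simp: s_def)
        then show ?thesis using N0 by (intro divide_left_mono) auto
      qed
      also have "\<dots> = 2 powr s * real N powr (- s)"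
        using N0 by (simp add: powr_divide powr_minus_divide)
      also have "\<dots> \<le> 4 * real N powr (- s)"
      proof -
        have "(2 :: real) powr s \<le> 2 powr 2" using \<delta> by (intro powr_mono) (auto simp: s_def)
        then show ?thesis by (intro mult_right_mono) auto
      qed
      also have "\<dots> \<le> real N powr (\<delta> / 2) * real N powr (- s)"
      proof (intro mult_right_mono)
        have "4 = (4 powr (2 / \<delta>)) powr (\<delta> / 2)" using \<delta> by (simp add: powr_powr)
        also have "\<dots> \<le> real N powr (\<delta> / 2)" using N(2) \<delta> by (intro powr_mono2) auto
        finally show "4 \<le> real N powr (\<delta> / 2)" .
      qed auto
      also have "\<dots> = real N powr (\<delta> - 2)"
        by (simp add: s_def algebra_simps flip: powr_add)
      also have "\<dots> = real N powr \<delta> / real N ^ 2"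
        using N0 by (simp add: powr_diff powr_numeral)
      finally show ?thesis by simp
    qed
    have "\<forall>\<^sub>F N in sequentially. real N \<ge> 4 powr (2 / \<delta>)"
      using filterlim_real_sequentially by (simp add: filterlim_at_top)
    with eventually_ge_at_top[of "2 ^ k0"]
    show "\<forall>\<^sub>F N in sequentially. min_gap (frac_dot a x) N \<le> real N powr \<delta> / real N ^ 2"
      by eventually_elim (rule le)
  qed
qed

theorem theorem1p4:
  fixes a :: "'d::finite \<Rightarrow> nat \<Rightarrow> nat"
  assumes "CARD('d) \<ge> 2"
    and "\<And>i. strict_mono_on {1..} (a i)"
    and "\<And>\<eta>::real. \<eta> > 0 \<Longrightarrow>
           (\<lambda>N. real (MIN i. additive_energy (a i) N)) \<in> O(\<lambda>N. real N powr (2 + \<eta>))"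
  shows "\<forall>\<delta>>0. AE \<alpha> in lebesgue_on {\<alpha> :: real ^ 'd. \<forall>i. 0 \<le> \<alpha> $ i \<and> \<alpha> $ i \<le> 1}.
           \<forall>\<^sub>F N in sequentially. min_gap (frac_dot a \<alpha>) N \<le> real N powr \<delta> / real N ^ 2"
proof (intro allI impI)
  fix \<delta> :: real
  assume "\<delta> > 0"
  have cube: "{\<alpha> :: real ^ 'd. \<forall>i. 0 \<le> \<alpha> $ i \<and> \<alpha> $ i \<le> 1} = cbox 0 1"
    by (auto simp: mem_box_cart)
  \<comment> \<open>The exponent is capped at \<open>1\<close> to meet the assumption of
    \<open>AE_min_gap_le\<close>; a smaller exponent gives a stronger bound once
    \<open>N \<ge> 1\<close>.\<close>
  have "AE \<alpha> in lborel. \<alpha> \<in> cbox 0 1 \<longrightarrow>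
      (\<forall>\<^sub>F N in sequentially. min_gap (frac_dot a \<alpha>) N \<le> real N powr (min \<delta> 1) / real N ^ 2)"
    using \<open>\<delta> > 0\<close> by (intro AE_min_gap_le assms(2,3)) auto
  then have "AE \<alpha> in lborel. \<alpha> \<in> cbox 0 1 \<longrightarrow>
      (\<forall>\<^sub>F N in sequentially. min_gap (frac_dot a \<alpha>) N \<le> real N powr \<delta> / real N ^ 2)"
  proof (rule AE_mp, intro AE_I2 impI)
    fix \<alpha> :: "real ^ 'd"
    assume "\<alpha> \<in> cbox 0 1 \<longrightarrow>
      (\<forall>\<^sub>F N in sequentially. min_gap (frac_dot a \<alpha>) N \<le> real N powr (min \<delta> 1) / real N ^ 2)" "\<alpha> \<in> cbox 0 1"
    then have "\<forall>\<^sub>F N in sequentially. min_gap (frac_dot a \<alpha>) N \<le> real N powr (min \<delta> 1) / real N ^ 2"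
      by blast
    then show "\<forall>\<^sub>F N in sequentially. min_gap (frac_dot a \<alpha>) N \<le> real N powr \<delta> / real N ^ 2"
      using eventually_ge_at_top[of 1]
    proof eventually_elim
      case (elim N)
      have "real N powr (min \<delta> 1) \<le> real N powr \<delta>"
        using elim(2) by (intro powr_mono) auto
      then have "real N powr (min \<delta> 1) / real N ^ 2 \<le> real N powr \<delta> / real N ^ 2"
        by (rule divide_right_mono) simp
      with elim(1) show ?case by (rule order_trans)
    qed
  qed
  then show "AE \<alpha> in lebesgue_on {\<alpha> :: real ^ 'd. \<forall>i. 0 \<le> \<alpha> $ i \<and> \<alpha> $ i \<le> 1}.
      \<forall>\<^sub>F N in sequentially. min_gap (frac_dot a \<alpha>) N \<le> real N powr \<delta> / real N ^ 2"
    unfolding cube by (subst AE_restrict_space_iff) (auto intro: AE_completion)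
qed
end
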